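(* For every linearly ordered set $J$, the class $\mathrm{NA}(\mathcal{B}_J^u)$ satisfies the Ramsey property.
   Context: Let $J$ be a linearly ordered set and let $L_J=\{\vee,\wedge,0,1,\neg\}\cup\{P_j:j\in J\}$ be the language of Boolean algebras expanded by unary predicate symbols $P_j$ ($j\in J$). An ideal on a Boolean algebra is a subset containing $0$, downward closed under the canonical order and closed under finite joins; ideals are assumed non-trivial, i.e. not containing $1$. $\mathcal{B}_J^u$ is the class of (isomorphism types of) finite Boolean algebras $A$ in the language $L_J$ in which each $P_j$ is interpreted as an ideal, $P_i\subseteq P_j$ for $i<j$ in $J$, and every atom of $A$ except exactly one belongs to some $P_j$, $j\in J$ (so exactly one atom lies in no $P_j$). Proper and natural orderings: a linear ordering $<$ of the atoms of a finite $L_J$-algebra $A$ is proper if for all atoms $a,b$ of $A$ and all $i\in J$ with $a\in P_i$, we have $a<b$ whenever either $b\in P_j\setminus P_i$ for some $j>i$, or $b\notin P_k$ for every $k\in J$. A linear ordering of $A$ is natural if it is the antilexicographical extension of a proper ordering $a_1<\dots<a_n$ of its atoms: for distinct $x,y\in A$, $x<y$ iff, for the largest $m$ such that exactly one of $a_m\le x$, $a_m\le y$ holds (with $\le$ the Boolean order), we have $a_m\le y$. $\mathrm{NA}(\mathcal{B}_J^u)$ is the class of all structures $(A,<)$ in the language $L_J\cup\{<\}$ with $A\in\mathcal{B}_J^u$ and $<$ a natural ordering of $A$. Ramsey property: a class $\mathcal{K}$ of finite structures satisfies the Ramsey property if for all $A,B\in\mathcal{K}$ such that $A$ embeds in $B$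 and every natural number $k\ge 2$ there is $C\in\mathcal{K}$ such that for every colouring by $k$ colours of the set of copies of $A$ in $C$ (substructures of $C$ isomorphic to $A$) there is a copy $B'$ of $B$ in $C$ such that all copies of $A$ in $B'$ have the same colour. *)

theory Defs
  imports Main
begin

text \<open>
  A structure in the language \<open>L_J\<close> has its universe inside a type \<open>'a\<close>. All notions
  below use the operations only on the universe and the predicates only at indices in \<open>J\<close>; the
  values elsewhere are irrelevant.
\<close>

record ('a, 'j) lj_structure =
  univ :: "'a set"
  join :: "'a \<Rightarrow> 'a \<Rightarrow> 'a"
  meet :: "'a \<Rightarrow> 'a \<Rightarrow> 'a"
  zero :: 'a
  one :: 'a
  compl :: "'a \<Rightarrow> 'a"
  pred :: "'j \<Rightarrow> 'a set"

record ('a, 'j) ordered_lj_structure = "('a, 'j) lj_structure" +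
  ord_rel :: "'a rel"

text \<open>The axioms of the library locale \<^locale>\<open>abstract_boolean_algebra\<close>, relativised to the universe.\<close>

locale boolean_algebra_structure =
  fixes A :: "('a, 'j, 'm) lj_structure_scheme"
  assumes join_closed: "\<lbrakk>x \<in> univ A; y \<in> univ A\<rbrakk> \<Longrightarrow> join A x y \<in> univ A"
    and meet_closed: "\<lbrakk>x \<in> univ A; y \<in> univ A\<rbrakk> \<Longrightarrow> meet A x y \<in> univ A"
    and zero_closed: "zero A \<in> univ A"
    and one_closed: "one A \<in> univ A"
    and compl_closed: "x \<in> univ A \<Longrightarrow> compl A x \<in> univ A"
    and join_assoc: "\<lbrakk>x \<in> univ A; y \<in> univ A; z \<in> univ A\<rbrakk>
          \<Longrightarrow> join A (join A x y) z = join A x (join A y z)"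
    and join_commute: "\<lbrakk>x \<in> univ A; y \<in> univ A\<rbrakk> \<Longrightarrow> join A x y = join A y x"
    and meet_assoc: "\<lbrakk>x \<in> univ A; y \<in> univ A; z \<in> univ A\<rbrakk>
          \<Longrightarrow> meet A (meet A x y) z = meet A x (meet A y z)"
    and meet_commute: "\<lbrakk>x \<in> univ A; y \<in> univ A\<rbrakk> \<Longrightarrow> meet A x y = meet A y x"
    and meet_join_distrib: "\<lbrakk>x \<in> univ A; y \<in> univ A; z \<in> univ A\<rbrakk>
          \<Longrightarrow> meet A x (join A y z) = join A (meet A x y) (meet A x z)"
    and join_meet_distrib: "\<lbrakk>x \<in> univ A; y \<in> univ A; z \<in> univ A\<rbrakk>
          \<Longrightarrow> join A x (meet A y z) = meet A (join A x y) (join A x z)"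
    and meet_one: "x \<in> univ A \<Longrightarrow> meet A x (one A) = x"
    and join_zero: "x \<in> univ A \<Longrightarrow> join A x (zero A) = x"
    and meet_compl: "x \<in> univ A \<Longrightarrow> meet A x (compl A x) = zero A"
    and join_compl: "x \<in> univ A \<Longrightarrow> join A x (compl A x) = one A"

definition below :: "('a, 'j, 'm) lj_structure_scheme \<Rightarrow> 'a \<Rightarrow> 'a \<Rightarrow> bool" where
  "below A x y \<longleftrightarrow> meet A x y = x"

definition atoms :: "('a, 'j, 'm) lj_structure_scheme \<Rightarrow> 'a set" where
  "atoms A = {a \<in> univ A. a \<noteq> zero A \<and> (\<forall>x\<in>univ A. below A x a \<longrightarrow> x = zero A \<or> x = a)}"

definition nontrivial_ideal :: "('a, 'j, 'm) lj_structure_scheme \<Rightarrow> 'a set \<Rightarrow> bool" where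
  "nontrivial_ideal A I \<longleftrightarrow>
     I \<subseteq> univ A \<and> zero A \<in> I \<and> one A \<notin> I \<and>
     (\<forall>x\<in>univ A. \<forall>y\<in>I. below A x y \<longrightarrow> x \<in> I) \<and>
     (\<forall>x\<in>I. \<forall>y\<in>I. join A x y \<in> I)"

text \<open>
  The linear order on the index set \<open>J\<close> is given by a reflexive relation \<open>r\<close>.
\<close>

definition Bu :: "'j set \<Rightarrow> 'j rel \<Rightarrow> ('a, 'j, 'm) lj_structure_scheme set" where
  "Bu J r = {A.
     finite (univ A) \<and> boolean_algebra_structure A \<and>
     (\<forall>j\<in>J. nontrivial_ideal A (pred A j)) \<and>
     (\<forall>i\<in>J. \<forall>j\<in>J. (i, j) \<in> r \<and> i \<noteq> j \<longrightarrow> pred A i \<subseteq> pred A j) \<and>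
     (\<exists>!a. a \<in> atoms A \<and> (\<forall>j\<in>J. a \<notin> pred A j))}"

definition proper_ordering ::
  "'j set \<Rightarrow> 'j rel \<Rightarrow> ('a, 'j, 'm) lj_structure_scheme \<Rightarrow> 'a rel \<Rightarrow> bool" where
  "proper_ordering J r A s \<longleftrightarrow>
     s \<subseteq> atoms A \<times> atoms A \<and> strict_linear_order_on (atoms A) s \<and>
     (\<forall>a\<in>atoms A. \<forall>b\<in>atoms A. \<forall>i\<in>J.
        a \<in> pred A i \<and>
        ((\<exists>j\<in>J. (i, j) \<in> r \<and> i \<noteq> j \<and> b \<in> pred A j - pred A i) \<or> (\<forall>k\<in>J. b \<notin> pred A k))
        \<longrightarrow> (a, b) \<in> s)"

definition separating_atoms :: "('a, 'j, 'm) lj_structure_scheme \<Rightarrow> 'a \<Rightarrow> 'a \<Rightarrow> 'a set" where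
  "separating_atoms A x y = {a \<in> atoms A. below A a x \<noteq> below A a y}"

definition antilex_extension :: "('a, 'j, 'm) lj_structure_scheme \<Rightarrow> 'a rel \<Rightarrow> 'a rel" where
  "antilex_extension A s = {(x, y). x \<in> univ A \<and> y \<in> univ A \<and> x \<noteq> y \<and>
     (\<exists>a\<in>separating_atoms A x y.
        (\<forall>b\<in>separating_atoms A x y. b \<noteq> a \<longrightarrow> (b, a) \<in> s) \<and> below A a y)}"

definition natural_ordering ::
  "'j set \<Rightarrow> 'j rel \<Rightarrow> ('a, 'j, 'm) lj_structure_scheme \<Rightarrow> 'a rel \<Rightarrow> bool" where
  "natural_ordering J r A t \<longleftrightarrow> (\<exists>s. proper_ordering J r A s \<and> t = antilex_extension A s)"

definition NA_Bu :: "'j set \<Rightarrow> 'j rel \<Rightarrow> ('a, 'j) ordered_lj_structure set" where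
  "NA_Bu J r = {A. A \<in> Bu J r \<and> natural_ordering J r A (ord_rel A)}"

definition embedding ::
  "'j set \<Rightarrow> ('a, 'j) ordered_lj_structure \<Rightarrow> ('b, 'j) ordered_lj_structure \<Rightarrow> ('a \<Rightarrow> 'b) \<Rightarrow> bool"
  where
  "embedding J A B f \<longleftrightarrow>
     f ` univ A \<subseteq> univ B \<and> inj_on f (univ A) \<and>
     (\<forall>x\<in>univ A. \<forall>y\<in>univ A. f (join A x y) = join B (f x) (f y)) \<and>
     (\<forall>x\<in>univ A. \<forall>y\<in>univ A. f (meet A x y) = meet B (f x) (f y)) \<and>
     f (zero A) = zero B \<and> f (one A) = one B \<and>
     (\<forall>x\<in>univ A. f (compl A x) = compl B (f x)) \<and>
     (\<forall>j\<in>J. \<forall>x\<in>univ A. x \<in> pred A j \<longleftrightarrow> f x \<in> pred B j) \<and>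
     (\<forall>x\<in>univ A. \<forall>y\<in>univ A. (x, y) \<in> ord_rel A \<longleftrightarrow> (f x, f y) \<in> ord_rel B)"

definition embeds ::
  "'j set \<Rightarrow> ('a, 'j) ordered_lj_structure \<Rightarrow> ('b, 'j) ordered_lj_structure \<Rightarrow> bool" where
  "embeds J A B \<longleftrightarrow> (\<exists>f. embedding J A B f)"

definition isomorphic ::
  "'j set \<Rightarrow> ('a, 'j) ordered_lj_structure \<Rightarrow> ('b, 'j) ordered_lj_structure \<Rightarrow> bool" where
  "isomorphic J A B \<longleftrightarrow> (\<exists>f. embedding J A B f \<and> f ` univ A = univ B)"

definition subuniverse :: "('a, 'j, 'm) lj_structure_scheme \<Rightarrow> 'a set \<Rightarrow> bool" where
  "subuniverse C S \<longleftrightarrow>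
     S \<subseteq> univ C \<and> zero C \<in> S \<and> one C \<in> S \<and>
     (\<forall>x\<in>S. compl C x \<in> S) \<and> (\<forall>x\<in>S. \<forall>y\<in>S. join C x y \<in> S \<and> meet C x y \<in> S)"

definition induced ::
  "('a, 'j) ordered_lj_structure \<Rightarrow> 'a set \<Rightarrow> ('a, 'j) ordered_lj_structure" where
  "induced C S = C\<lparr>univ := S, pred := \<lambda>j. pred C j \<inter> S, ord_rel := ord_rel C \<inter> S \<times> S\<rparr>"

text \<open>
  Substructures keep the ambient operations unchanged outside their universe, so the substructures
  of \<open>C\<close> correspond exactly to its subuniverses, and substructures of a substructure of \<open>C\<close> are
  themselves substructures of \<open>C\<close>.
\<close>

definition copies ::
  "'j set \<Rightarrow> ('a, 'j) ordered_lj_structure \<Rightarrow> ('b, 'j) ordered_lj_structure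
     \<Rightarrow> ('b, 'j) ordered_lj_structure set" where
  "copies J A C = {induced C S | S. subuniverse C S \<and> isomorphic J A (induced C S)}"

definition ramsey_property :: "'j set \<Rightarrow> ('a, 'j) ordered_lj_structure set \<Rightarrow> bool" where
  "ramsey_property J K \<longleftrightarrow>
     (\<forall>A\<in>K. \<forall>B\<in>K. embeds J A B \<longrightarrow>
       (\<forall>k::nat. 2 \<le> k \<longrightarrow>
         (\<exists>C\<in>K. \<forall>\<chi> :: ('a, 'j) ordered_lj_structure \<Rightarrow> nat.
            \<chi> ` copies J A C \<subseteq> {..<k} \<longrightarrow>
            (\<exists>B'\<in>copies J B C. \<exists>c. \<forall>A'\<in>copies J A B'. \<chi> A' = c))))"

end

theory Submission
  imports Defs
begin

text \<open>
  A finite Boolean algebra is dual to its set of atoms: an embedding of \<open>A\<close> into \<open>C\<close> is the same as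
  a surjection from the atoms of \<open>C\<close> onto those of \<open>A\<close>, which sends an atom \<open>c\<close> to the atom of \<open>A\<close>
  whose image lies above \<open>c\<close>. Call the set of all \<open>j\<close> with \<open>a \<in> P\<^sub>j\<close> the level of the atom \<open>a\<close>.
  In a natural ordering, listed from the largest atom down, the levels form an increasing
  chain of sets, and the unique atom that lies in no ideal comes first. Read the surjection as a
  word: position \<open>p\<close> carries the index of the image of the \<open>p\<close>-th atom of \<open>C\<close>. The embedding
  preserves the antilexicographic order iff the letters \<open>0, 1, 2, \<dots>\<close> make their first occurrences
  in this order, and it preserves the ideals iff the first occurrence of every letter is at a
  position of the level of that letter: an ideal contains a join of atoms iff it contains all of
  them, so the level of the join is the smallest of their levels, which is the level of the first
  of them. Such words are parameter words with levels, and composition of embeddings is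
  substitution of words. These translations are the lemmas \<open>NA_Bu_representation\<close>,
  \<open>word_embedding\<close>, \<open>embedding_is_word\<close> and, for the way back from lists of levels to structures,
  \<open>push_forward_power_structure\<close>.

  What remains is the Graham--Rothschild theorem with levels, \<open>parameter_word_ramsey\<close>, proved by
  induction on the number of parameters of the coloured words. A coloured word splits as
  \<open>x @ \<lambda> # y\<close>, where \<open>\<lambda>\<close> is the first occurrence of the first parameter. In \<open>y\<close> the letter \<open>\<lambda>\<close>
  is a constant, so the induction hypothesis, for an alphabet with one more letter, makes the
  colour independent of \<open>y\<close> (\<open>first_parameter_colouring\<close>). The Hales--Jewett theorem, applied block
  by block, makes it depend only on the length of \<open>x\<close> (\<open>prefix_colouring\<close>). Finally the pigeonhole
  principle, applied to the positions of the level of \<open>\<lambda>\<close>, gets rid of the length as well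
  (\<open>level_pigeonhole\<close>); here it matters that the levels are sorted, so that the positions of one
  level are consecutive. The Hales--Jewett theorem itself is proved by Shelah's argument.
\<close>

section \<open>Colourings\<close>

text \<open>
  Finitely many bounded colourings amount to a single one with more colours, namely the digits of a
  number in base \<open>r\<close>. The bound \<open>k\<close> must not depend on the colourings, because the lengths of words
  in the Ramsey arguments are chosen before the colouring is given.
\<close>

lemma joint_colouring:
  fixes r :: nat
  assumes "finite X"
  shows "\<exists>k. \<forall>\<chi>. (\<forall>x y. \<chi> x y < r) \<longrightarrow>
    (\<exists>\<psi> :: 'b \<Rightarrow> nat. (\<forall>y. \<psi> y < k) \<and> (\<forall>y y'. \<psi> y = \<psi> y' \<longrightarrow> (\<forall>x\<in>X. \<chi> x y = \<chi> x y')))"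
  using assms
proof (induction X)
  case empty
  show ?case
    by (rule exI[of _ 1]) (auto intro!: exI[of _ "\<lambda>_. 0"])
next
  case (insert x X)
  from insert.IH obtain k where k: "\<forall>\<chi>. (\<forall>x y. \<chi> x y < r) \<longrightarrow>
    (\<exists>\<psi> :: 'b \<Rightarrow> nat. (\<forall>y. \<psi> y < k) \<and> (\<forall>y y'. \<psi> y = \<psi> y' \<longrightarrow> (\<forall>x\<in>X. \<chi> x y = \<chi> x y')))"
    by (rule exE) (rule that)
  show ?case
  proof (intro exI[of _ "k * r"] allI impI)
    fix \<chi> :: "'a \<Rightarrow> 'b \<Rightarrow> nat" assume \<chi>: "\<forall>x y. \<chi> x y < r"
    obtain \<psi> where \<psi>: "\<And>y. \<psi> y < k"
      "\<And>y y'. \<psi> y = \<psi> y' \<Longrightarrow> \<forall>x\<in>X. \<chi> x y = \<chi> x y'"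
      using k[rule_format, of \<chi>] \<chi> by blast
    let ?\<phi> = "\<lambda>y. \<psi> y * r + \<chi> x y"
    have "?\<phi> y < k * r" for y
    proof -
      have "?\<phi> y < Suc (\<psi> y) * r" using \<chi> by simp
      also have "\<dots> \<le> k * r" using \<psi>(1)[of y] by (intro mult_le_mono1) simp
      finally show ?thesis .
    qed
    moreover have "\<psi> y = \<psi> y' \<and> \<chi> x y = \<chi> x y'" if "?\<phi> y = ?\<phi> y'" for y y'
    proof -
      have "?\<phi> z div r = \<psi> z" "?\<phi> z mod r = \<chi> x z" for z using \<chi>[rule_format, of x z] by auto
      then show ?thesis using that by metis
    qed
    ultimately show "\<exists>\<psi>. (\<forall>y. \<psi> y < k * r) \<and>
        (\<forall>y y'. \<psi> y = \<psi> y' \<longrightarrow> (\<forall>x\<in>insert x X. \<chi> x y = \<chi> x y'))"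
      using \<psi>(2) by (intro exI[of _ ?\<phi>]) blast
  qed
qed

lemma colouring_factors:
  fixes r :: nat
  assumes "\<And>v. \<chi> v < r" and "\<And>v w. \<lbrakk>P v; P w; f v = f w\<rbrakk> \<Longrightarrow> \<chi> v = \<chi> w"
  shows "\<exists>h. (\<forall>x. h x < r) \<and> (\<forall>v. P v \<longrightarrow> \<chi> v = h (f v))"
proof (intro exI conjI allI impI)
  let ?h = "\<lambda>x. \<chi> (SOME v. P v \<and> f v = x)"
  show "?h x < r" for x by (rule assms)
  show "\<chi> v = ?h (f v)" if "P v" for v
    using someI[of "\<lambda>w. P w \<and> f w = f v" v] that by (intro assms) auto
qed

section \<open>Parameter words\<close>

text \<open>
  Parameter words, or restricted growth strings: the letters below \<open>a\<close> are constants, and the \<open>i\<close>-th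
  parameter is the letter \<open>a + i\<close>. The list \<open>as\<close> gives the levels of the parameters, \<open>cs\<close> those of the
  positions. Scanning the word from the left, each letter is either known already or is the next
  parameter, at a position of the right level; from then on it counts as a constant.
\<close>

fun pword :: "nat \<Rightarrow> 'l list \<Rightarrow> 'l list \<Rightarrow> nat list \<Rightarrow> bool" where
  "pword a as [] [] \<longleftrightarrow> as = []"
| "pword a as (c # cs) (x # w) \<longleftrightarrow>
     x < a \<and> pword a as cs w \<or> x = a \<and> (\<exists>as'. as = c # as' \<and> pword (Suc a) as' cs w)"
| "pword a as _ _ \<longleftrightarrow> False"

text \<open>
  Substitution: the letter \<open>i\<close> of \<open>u\<close> is replaced by the \<open>i\<close>-th entry of \<open>t\<close>. To substitute \<open>v\<close> for the
  parameters only, take \<open>t = [0..<a] @ v\<close>.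
\<close>

abbreviation plug :: "nat list \<Rightarrow> nat list \<Rightarrow> nat list" where
  "plug t u \<equiv> map ((!) t) u"

lemma pword_length: "pword a as cs w \<Longrightarrow> length w = length cs"
  by (induction a as cs w rule: pword.induct) auto

lemma pword_letters: "pword a as cs w \<Longrightarrow> set w \<subseteq> {..<a + length as}"
  by (induction a as cs w rule: pword.induct) fastforce+

lemma pword_no_parameters: "pword a [] cs w \<longleftrightarrow> length w = length cs \<and> set w \<subseteq> {..<a}"
  by (induction a "[] :: 'a list" cs w rule: pword.induct) auto

lemma pword_identity: "pword a as as [a..<a + length as]"
  by (induction as arbitrary: a) (auto simp: upt_conv_Cons simp flip: add_Suc)

lemma pword_append:
  "pword a as cs w \<Longrightarrow> pword (a + length as) as' cs' w' \<Longrightarrow> pword a (as @ as') (cs @ cs') (w @ w')"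
  by (induction a as cs w rule: pword.induct) auto

text \<open>
  The scan moves the images of letters seen so far from \<open>v\<close> to \<open>s\<close>; the induction therefore needs
  arbitrary images \<open>s\<close> of the constants.
\<close>

lemma pword_plug:
  assumes "pword a bs cs u" "pword a' as bs v" "length s = a" "set s \<subseteq> {..<a'}"
  shows "pword a' as cs (plug (s @ v) u)"
  using assms
proof (induction a bs cs u arbitrary: a' as s v rule: pword.induct)
  case (1 a as)
  then show ?case by (cases v) auto
next
  case (2 a bs c cs x u)
  show ?case
  proof (cases "x < a")
    case True
    then have "s ! x < a'" using 2 by (metis lessThan_iff nth_mem subsetD)
    then show ?thesis using 2 True by (auto simp: nth_append)
  next
    case False
    then obtain bs' where bs: "x = a" "bs = c # bs'" "pword (Suc a) bs' cs u" using 2 by auto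
    then obtain y v' where v: "v = y # v'" using 2 by (cases v) auto
    consider "y < a'" "pword a' as bs' v'" |
      as' where "y = a'" "as = c # as'" "pword (Suc a') as' bs' v'"
      using 2 bs v by auto
    then show ?thesis
    proof cases
      case 1
      have "pword a' as cs (plug ((s @ [y]) @ v') u)"
        by (rule 2(2)) (use 1 2 bs in auto)
      then show ?thesis using bs v 1 2 by auto
    next
      case (2 as')
      have "pword (Suc a') as' cs (plug ((s @ [y]) @ v') u)"
        by (rule "2.IH"(2)) (use 2 "2.prems" bs in auto)
      then show ?thesis using bs v 2 "2.prems" by auto
    qed
  qed
qed auto

lemma plug_plug: "set u \<subseteq> {..<length v} \<Longrightarrow> plug t (plug v u) = plug (plug t v) u"
  by auto

lemma plug_upt: "a \<le> length t \<Longrightarrow> plug t [0..<a] = take a t"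
  by (intro nth_equalityI) auto

lemma plug_append1: "set u \<subseteq> {..<length s} \<Longrightarrow> plug (s @ t) u = plug s u"
  by (auto simp: nth_append)

lemma pword_plug_alphabet:
  "pword a bs cs u \<Longrightarrow> pword a as bs v \<Longrightarrow> pword a as cs (plug ([0..<a] @ v) u)"
  by (rule pword_plug) auto

lemma plug_plug_alphabet:
  assumes "pword a bs cs u" "length w = length bs" "length t = a"
  shows "plug (t @ v) (plug ([0..<a] @ w) u) = plug (t @ plug (t @ v) w) u"
proof -
  have "set u \<subseteq> {..<length ([0..<a] @ w)}" using pword_letters[OF assms(1)] assms by auto
  then have "plug (t @ v) (plug ([0..<a] @ w) u) = plug (plug (t @ v) ([0..<a] @ w)) u"
    by (rule plug_plug)
  also have "plug (t @ v) ([0..<a] @ w) = t @ plug (t @ v) w"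
    using assms by (simp only: map_append) (simp add: plug_upt)
  finally show ?thesis .
qed

text \<open>
  Makes room for the new constant \<open>a\<close> by moving the parameters up. Prepending a block with a
  parameter of its own to a word needs this.
\<close>

abbreviation widen :: "nat \<Rightarrow> nat \<Rightarrow> nat list \<Rightarrow> nat list" where
  "widen a m u \<equiv> plug ([0..<a] @ [Suc a..<Suc a + m]) u"

lemma pword_widen: "pword a bs cs u \<Longrightarrow> pword (Suc a) bs cs (widen a (length bs) u)"
  by (rule pword_plug[OF _ pword_identity]) auto

lemma plug_widen:
  assumes "set u \<subseteq> {..<a + length v}" "length s = a"
  shows "plug (s @ x # v) (widen a (length v) u) = plug (s @ v) u"
proof -
  have "plug (s @ x # v) ([0..<a] @ [Suc a..<Suc a + length v]) = s @ v"
  proof -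
    have "plug (s @ x # v) [0..<a] = s" using assms(2) by (simp add: plug_upt)
    moreover have "plug (s @ x # v) [Suc a..<Suc a + length v] = v"
      using assms(2) by (intro nth_equalityI) (auto simp: nth_append simp del: upt_Suc)
    ultimately show ?thesis by (simp only: map_append)
  qed
  then show ?thesis using assms by (subst plug_plug) auto
qed

lemma plug_line_append:
  assumes e: "pword a [b] cs e" and u: "pword a bs cs' u" and v: "length v = length bs"
  shows "plug ([0..<a] @ x # v) (e @ widen a (length bs) u)
    = plug ([0..<a] @ [x]) e @ plug ([0..<a] @ v) u"
proof -
  have "plug (([0..<a] @ [x]) @ v) e = plug ([0..<a] @ [x]) e"
    using pword_letters[OF e] by (intro plug_append1) auto
  moreover have "plug ([0..<a] @ x # v) (widen a (length bs) u) = plug ([0..<a] @ v) u"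
    using pword_letters[OF u] v plug_widen[of u a v "[0..<a]" x] by simp
  ultimately show ?thesis by simp
qed

section \<open>The Hales--Jewett theorem\<close>

lemma finite_words: "finite {x. length x = n \<and> set x \<subseteq> {..<a::nat}}"
  using finite_lists_length_eq[of "{..<a}" n] by (simp add: conj_commute)

text \<open>
  The core of Shelah's proof. With \<open>a = m + 2\<close> constants, some \<open>n\<close>-dimensional subspace has colours
  that do not see the difference between the constants \<open>m\<close> and \<open>m + 1\<close>. Each dimension comes from a
  block in which words \<open>m\<dots>m (m+1)\<dots>(m+1)\<close> are compared: two of them receive the same colour in all
  contexts, and the line that varies on the segment where they differ joins them. A context of a
  block is a full word on the blocks before it but a word of the subspace on the blocks after it,
  which is why the block lengths can be chosen without circularity.
\<close>

lemma insensitive_subspace: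
  fixes b :: 'l and m :: nat
  defines "a \<equiv> Suc (Suc m)"
  shows "\<exists>N. \<forall>\<chi>. (\<forall>w. \<chi> w < r) \<longrightarrow>
    (\<exists>u. pword a (replicate n b) (replicate N b) u \<and>
      (\<forall>v v'. length v = n \<and> set v \<subseteq> {..<a} \<and> set v' \<subseteq> {..<a} \<and> map (min m) v = map (min m) v' \<longrightarrow>
        \<chi> (plug ([0..<a] @ v) u) = (\<chi> (plug ([0..<a] @ v') u) :: nat)))"
proof (induction n arbitrary: r)
  case 0
  show ?case by (rule exI[of _ 0]) (auto intro!: exI[of _ "[]"])
next
  case (Suc n)
  obtain k where k: "\<forall>\<chi>. (\<forall>x y. \<chi> x y < r) \<longrightarrow>
      (\<exists>\<psi> :: nat list \<Rightarrow> nat. (\<forall>y. \<psi> y < k) \<and> (\<forall>y y'. \<psi> y = \<psi> y' \<longrightarrow>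
        (\<forall>x\<in>{x. length x = n \<and> set x \<subseteq> {..<a}}. \<chi> x y = \<chi> x y')))"
    using joint_colouring[OF finite_words] by (rule exE) (rule that)
  obtain k2 where k2: "\<forall>\<chi>. (\<forall>x y. \<chi> x y < r) \<longrightarrow>
      (\<exists>\<psi> :: nat list \<Rightarrow> nat. (\<forall>y. \<psi> y < k2) \<and> (\<forall>y y'. \<psi> y = \<psi> y' \<longrightarrow>
        (\<forall>x\<in>{x. length x = k \<and> set x \<subseteq> {..<a}}. \<chi> x y = \<chi> x y')))"
    using joint_colouring[OF finite_words] by (rule exE) (rule that)
  obtain N where N: "\<forall>\<chi>. (\<forall>w. \<chi> w < k2) \<longrightarrow>
    (\<exists>u. pword a (replicate n b) (replicate N b) u \<and>
      (\<forall>v v'. length v = n \<and> set v \<subseteq> {..<a} \<and> set v' \<subseteq> {..<a} \<and> map (min m) v = map (min m) v' \<longrightarrow>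
        \<chi> (plug ([0..<a] @ v) u) = (\<chi> (plug ([0..<a] @ v') u) :: nat)))"
    using Suc[of k2] by (rule exE) (rule that)
  show ?case
  proof (intro exI[of _ "k + N"] allI impI)
    fix \<chi> :: "nat list \<Rightarrow> nat" assume \<chi>: "\<forall>w. \<chi> w < r"
    obtain \<psi> where \<psi>: "\<And>y. \<psi> y < k2" "\<And>y y' x. \<lbrakk>\<psi> y = \<psi> y'; length x = k; set x \<subseteq> {..<a}\<rbrakk>
        \<Longrightarrow> \<chi> (x @ y) = \<chi> (x @ y')"
      using k2[rule_format, of "\<lambda>x y. \<chi> (x @ y)"] \<chi> by auto
    obtain u where u: "pword a (replicate n b) (replicate N b) u"
      and u': "\<And>v v'. \<lbrakk>length v = n; set v \<subseteq> {..<a}; set v' \<subseteq> {..<a}; map (min m) v = map (min m) v'\<rbrakk>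
        \<Longrightarrow> \<psi> (plug ([0..<a] @ v) u) = \<psi> (plug ([0..<a] @ v') u)"
      using N[rule_format, of \<psi>] \<psi>(1) by blast
    obtain \<phi> where \<phi>: "\<And>y. \<phi> y < k" "\<And>y y' v. \<lbrakk>\<phi> y = \<phi> y'; length v = n; set v \<subseteq> {..<a}\<rbrakk>
        \<Longrightarrow> \<chi> (y @ plug ([0..<a] @ v) u) = \<chi> (y' @ plug ([0..<a] @ v) u)"
      using k[rule_format, of "\<lambda>v y. \<chi> (y @ plug ([0..<a] @ v) u)"] \<chi> by auto
    \<comment> \<open>the threshold words of the block; by pigeonhole two of the \<open>k + 1\<close> look alike\<close>
    define step where "step i = replicate i m @ replicate (k - i) (Suc m)" for i
    have "\<not> inj_on (\<lambda>i. \<phi> (step i)) {..k}"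
    proof
      assume "inj_on (\<lambda>i. \<phi> (step i)) {..k}"
      then have "card {..k} \<le> card {..<k}" by (rule card_inj_on_le) (auto simp: \<phi>(1))
      then show False by simp
    qed
    then obtain i i' where i: "i < i'" "i' \<le> k" "\<phi> (step i) = \<phi> (step i')"
      unfolding inj_on_def by (metis atMost_iff linorder_neqE_nat)
    \<comment> \<open>the line through both: its parameter \<open>a\<close> fills the segment where they differ\<close>
    define e where "e = replicate i m @ replicate (i' - i) a @ replicate (k - i') (Suc m)"
    have "pword a [] (replicate i b) (replicate i m)"
      and "pword (Suc a) [] (replicate ((i' - i - 1) + (k - i')) b)
            (replicate (i' - i - 1) a @ replicate (k - i') (Suc m))"
      by (auto simp: pword_no_parameters a_def)
    then have "pword a ([] @ [b]) (replicate i b @ b # replicate ((i' - i - 1) + (k - i')) b)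
       (replicate i m @ a # (replicate (i' - i - 1) a @ replicate (k - i') (Suc m)))"
      by (intro pword_append) auto
    moreover have "replicate i b @ b # replicate ((i' - i - 1) + (k - i')) b = replicate k b"
      using i by (simp flip: replicate_Suc replicate_add)
    moreover have "replicate (i' - i) a = a # replicate (i' - i - 1) a"
      using i by (cases "i' - i") auto
    ultimately have e: "pword a [b] (replicate k b) e" by (simp add: e_def)
    have e_m: "plug ([0..<a] @ [m]) e = step i'" "plug ([0..<a] @ [Suc m]) e = step i"
    proof -
      have "replicate (k - i) (Suc m) = replicate (i' - i) (Suc m) @ replicate (k - i') (Suc m)"
        and "replicate i' m = replicate i m @ replicate (i' - i) m"
        using i by (simp_all flip: replicate_add)
      then show "plug ([0..<a] @ [m]) e = step i'" "plug ([0..<a] @ [Suc m]) e = step i"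
        by (simp_all add: e_def step_def a_def nth_append)
    qed
    show "\<exists>u. pword a (replicate (Suc n) b) (replicate (k + N) b) u \<and>
      (\<forall>v v'. length v = Suc n \<and> set v \<subseteq> {..<a} \<and> set v' \<subseteq> {..<a} \<and> map (min m) v = map (min m) v' \<longrightarrow>
        \<chi> (plug ([0..<a] @ v) u) = \<chi> (plug ([0..<a] @ v') u))"
    proof (intro exI[of _ "e @ widen a n u"] conjI allI impI)
      show "pword a (replicate (Suc n) b) (replicate (k + N) b) (e @ widen a n u)"
        using pword_append[OF e, of "replicate n b" "replicate N b" "widen a n u"] pword_widen[OF u]
        by (simp add: replicate_add)
      fix v v' :: "nat list"
      assume *: "length v = Suc n \<and> set v \<subseteq> {..<a} \<and> set v' \<subseteq> {..<a} \<and> map (min m) v = map (min m) v'"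
      then obtain x w where v: "v = x # w" by (cases v) auto
      with * obtain x' w' where v': "v' = x' # w'" by (cases v') auto
      have len: "length w = n" "length w' = n" using * v v' by (auto dest: map_eq_imp_length_eq)
      have split: "plug ([0..<a] @ y # z) (e @ widen a n u) = plug ([0..<a] @ [y]) e @ plug ([0..<a] @ z) u"
        if "length z = n" for y z
        using plug_line_append[OF e u, of z y] that by simp
      have "length (plug ([0..<a] @ [x]) e) = k" "set (plug ([0..<a] @ [x]) e) \<subseteq> {..<a}"
        using pword_length[OF e] pword_letters[OF e] * v
        by (auto simp: nth_append split: if_splits)
      then have "\<chi> (plug ([0..<a] @ v) (e @ widen a n u))
          = \<chi> (plug ([0..<a] @ [x]) e @ plug ([0..<a] @ w') u)"
        unfolding v split[OF len(1)] using * v v' len by (intro \<psi>(2) u') auto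
      \<comment> \<open>only the letters \<open>m\<close> and \<open>m + 1\<close> can be interchanged, and on \<open>e\<close> they give the two threshold words\<close>
      also have "\<dots> = \<chi> (plug ([0..<a] @ [x']) e @ plug ([0..<a] @ w') u)"
      proof (cases "x = x'")
        case False
        then have "x = m \<and> x' = Suc m \<or> x = Suc m \<and> x' = m"
          using * v v' unfolding a_def by (auto simp: min_def split: if_splits)
        then have "\<phi> (plug ([0..<a] @ [x]) e) = \<phi> (plug ([0..<a] @ [x']) e)"
          using i(3) by (elim disjE conjE) (simp_all only: e_m)
        moreover have "set w' \<subseteq> {..<a}" using * v' by simp
        ultimately show ?thesis using len(2) by (intro \<phi>(2))
      qed simp
      finally show "\<chi> (plug ([0..<a] @ v) (e @ widen a n u)) = \<chi> (plug ([0..<a] @ v') (e @ widen a n u))"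
        unfolding v' split[OF len(2)] .
    qed
  qed
qed

text \<open>
  Induction on the number of constants. For \<open>m + 2\<close> constants, take a subspace that does not
  distinguish \<open>m\<close> from \<open>m + 1\<close>, and in it a line that is monochromatic for the constants up to \<open>m\<close>.
  All positions of the line have one level \<open>b\<close>, which its parameter inherits.
\<close>

theorem hales_jewett:
  fixes b :: 'l
  assumes "0 < a"
  shows "\<exists>n. \<forall>\<chi>. (\<forall>w. \<chi> w < r) \<longrightarrow>
    (\<exists>e. pword a [b] (replicate n b) e \<and>
      (\<forall>x<a. \<forall>y<a. \<chi> (plug ([0..<a] @ [x]) e) = (\<chi> (plug ([0..<a] @ [y]) e) :: nat)))"
proof -
  obtain m where "a = Suc m" using assms gr0_implies_Suc by blast
  moreover have "\<exists>n. \<forall>\<chi>. (\<forall>w. \<chi> w < r) \<longrightarrow>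
    (\<exists>e. pword (Suc m) [b] (replicate n b) e \<and>
      (\<forall>x<Suc m. \<forall>y<Suc m. \<chi> (plug ([0..<Suc m] @ [x]) e) = (\<chi> (plug ([0..<Suc m] @ [y]) e) :: nat)))"
  proof (induction m)
    case 0
    show ?case
    proof (intro exI[of _ 1] allI impI)
      show "\<exists>e. pword (Suc 0) [b] (replicate 1 b) e \<and>
        (\<forall>x<Suc 0. \<forall>y<Suc 0. \<chi> (plug ([0..<Suc 0] @ [x]) e) = \<chi> (plug ([0..<Suc 0] @ [y]) e))"
        for \<chi> :: "nat list \<Rightarrow> nat"
        by (rule exI[of _ "[Suc 0]"]) auto
    qed
  next
    case (Suc m)
    from Suc.IH obtain n where n: "\<forall>\<chi>. (\<forall>w. \<chi> w < r) \<longrightarrow>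
        (\<exists>e. pword (Suc m) [b] (replicate n b) e \<and>
          (\<forall>x<Suc m. \<forall>y<Suc m. \<chi> (plug ([0..<Suc m] @ [x]) e) = (\<chi> (plug ([0..<Suc m] @ [y]) e) :: nat)))"
      by (rule exE) (rule that)
    define a where "a = Suc (Suc m)"
    obtain N where N: "\<forall>\<chi>. (\<forall>w. \<chi> w < r) \<longrightarrow>
      (\<exists>u. pword a (replicate n b) (replicate N b) u \<and>
        (\<forall>v v'. length v = n \<and> set v \<subseteq> {..<a} \<and> set v' \<subseteq> {..<a} \<and> map (min m) v = map (min m) v' \<longrightarrow>
          \<chi> (plug ([0..<a] @ v) u) = (\<chi> (plug ([0..<a] @ v') u) :: nat)))"
      using insensitive_subspace[of r m n b, folded a_def] by (rule exE) (rule that)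
    have "\<exists>e. pword a [b] (replicate N b) e \<and>
        (\<forall>x<a. \<forall>y<a. \<chi> (plug ([0..<a] @ [x]) e) = \<chi> (plug ([0..<a] @ [y]) e))"
      if \<chi>: "\<forall>w. \<chi> w < r" for \<chi> :: "nat list \<Rightarrow> nat"
    proof -
      obtain u where u: "pword a (replicate n b) (replicate N b) u"
        and u': "\<And>v v'. \<lbrakk>length v = n; set v \<subseteq> {..<a}; set v' \<subseteq> {..<a}; map (min m) v = map (min m) v'\<rbrakk>
          \<Longrightarrow> \<chi> (plug ([0..<a] @ v) u) = \<chi> (plug ([0..<a] @ v') u)"
        using N[rule_format, of \<chi>] \<chi> by blast
      obtain e where e: "pword (Suc m) [b] (replicate n b) e"
        and e': "\<And>x y. \<lbrakk>x < Suc m; y < Suc m\<rbrakk> \<Longrightarrow>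
          \<chi> (plug ([0..<a] @ plug ([0..<Suc m] @ [x]) e) u) = \<chi> (plug ([0..<a] @ plug ([0..<Suc m] @ [y]) e) u)"
        using n[rule_format, of "\<lambda>v. \<chi> (plug ([0..<a] @ v) u)"] \<chi> by blast
      let ?e = "widen (Suc m) 1 e"
      have we: "pword a [b] (replicate n b) ?e" using pword_widen[OF e] by (simp add: a_def)
      have sub: "plug ([0..<a] @ [x]) (plug ([0..<a] @ ?e) u) = plug ([0..<a] @ plug ([0..<Suc m] @ [x]) e) u"
        for x
      proof -
        have "plug ([0..<a] @ [x]) ?e = plug ([0..<Suc m] @ [x]) e"
          using plug_widen[of e "Suc m" "[x]" "[0..<Suc m]" "Suc m"] pword_letters[OF e] by (simp add: a_def)
        moreover have "plug ([0..<a] @ [x]) (plug ([0..<a] @ ?e) u) = plug ([0..<a] @ plug ([0..<a] @ [x]) ?e) u"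
          using pword_length[OF e] by (intro plug_plug_alphabet[OF u]) simp_all
        ultimately show ?thesis by (simp only:)
      qed
      have collapse: "\<chi> (plug ([0..<a] @ plug ([0..<Suc m] @ [x]) e) u) = \<chi> (plug ([0..<a] @ plug ([0..<Suc m] @ [min m x]) e) u)"
        if "x < a" for x
        using that pword_length[OF e] pword_letters[OF e]
        by (intro u') (force simp: nth_append a_def less_Suc_eq min_def)+
      have const: "\<chi> (plug ([0..<a] @ [x]) (plug ([0..<a] @ ?e) u)) = \<chi> (plug ([0..<a] @ [y]) (plug ([0..<a] @ ?e) u))"
        if "x < a" "y < a" for x y
        unfolding sub collapse[OF that(1)] collapse[OF that(2)] by (rule e') simp_all
      show ?thesis
      proof (intro exI conjI allI impI)
        show "pword a [b] (replicate N b) (plug ([0..<a] @ ?e) u)" by (rule pword_plug_alphabet[OF u we])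
      qed (rule const)
    qed
    then show ?case unfolding a_def by blast
  qed
  ultimately show ?thesis by simp
qed

section \<open>The Graham--Rothschild theorem with levels\<close>

text \<open>
  The invariant of the constructions below, which replace every entry of \<open>bs\<close> by repetitions of it.
  It carries the properties of the levels of a structure over from \<open>bs\<close> to \<open>cs\<close>.
\<close>

definition sorted_over :: "'l::order list \<Rightarrow> 'l list \<Rightarrow> bool" where
  "sorted_over bs cs \<longleftrightarrow> sorted_wrt (\<le>) cs \<and> set cs \<subseteq> set bs"

lemma sorted_over_trans: "sorted_over bs cs \<Longrightarrow> sorted_over cs ds \<Longrightarrow> sorted_over bs ds"
  unfolding sorted_over_def by blast

lemma sorted_replicate: "sorted_wrt (\<le>) (replicate n (b :: 'l::order))"
  by (induction n) auto

lemma sorted_over_Cons: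
  assumes "sorted_wrt (\<le>) (b # bs)" "sorted_over bs cs"
  shows "sorted_over (b # bs) (replicate n b @ cs)"
  using assms unfolding sorted_over_def by (auto simp: sorted_wrt_append sorted_replicate)

text \<open>
  Here arbitrary words are coloured, and \<open>x\<close> is inserted into the part of \<open>u\<close> that comes before the
  parameter with number \<open>length x\<close> shows up; for \<open>length x = length bs\<close> this is all of \<open>u\<close>. Each entry
  of \<open>bs\<close> becomes a block of the same level that contains a line. The line for the head of \<open>bs\<close> is
  found by the Hales--Jewett theorem for the colour of a block as a function of the length of what
  follows. By the induction hypothesis, only this length counts, simultaneously for all words on
  the block.
\<close>

lemma prefix_colouring:
  fixes bs :: "'l::order list"
  assumes "0 < a" "sorted_wrt (\<le>) bs"
  shows "\<exists>cs. sorted_over bs cs \<and> (\<forall>\<chi>. (\<forall>w. \<chi> w < r) \<longrightarrow>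
    (\<exists>u. pword a bs cs u \<and>
      (\<forall>x x'. length x = length x' \<and> length x \<le> length bs \<and> set x \<subseteq> {..<a} \<and> set x' \<subseteq> {..<a} \<longrightarrow>
        \<chi> (plug ([0..<a] @ x) (takeWhile (\<lambda>y. y < a + length x) u))
          = (\<chi> (plug ([0..<a] @ x') (takeWhile (\<lambda>y. y < a + length x) u)) :: nat))))"
  using assms(2)
proof (induction bs arbitrary: r)
  case Nil
  show ?case by (rule exI[of _ "[]"]) (auto simp: sorted_over_def intro!: exI[of _ "[]"])
next
  case (Cons b bs)
  obtain k where k: "\<forall>\<chi>. (\<forall>x y. \<chi> x y < r) \<longrightarrow>
      (\<exists>\<psi> :: nat list \<Rightarrow> nat. (\<forall>y. \<psi> y < k) \<and> (\<forall>y y'. \<psi> y = \<psi> y' \<longrightarrow>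
        (\<forall>x\<in>{..length bs}. \<chi> x y = \<chi> x y')))"
    using joint_colouring[of "{..length bs}"] by (rule exE[OF _ that]) simp
  obtain n where n: "\<forall>\<chi>. (\<forall>w. \<chi> w < k) \<longrightarrow>
    (\<exists>e. pword a [b] (replicate n b) e \<and>
      (\<forall>x<a. \<forall>y<a. \<chi> (plug ([0..<a] @ [x]) e) = (\<chi> (plug ([0..<a] @ [y]) e) :: nat)))"
    using hales_jewett[OF assms(1)] by (rule exE) (rule that)
  obtain k2 where k2: "\<forall>\<chi>. (\<forall>x y. \<chi> x y < r) \<longrightarrow>
      (\<exists>\<psi> :: nat list \<Rightarrow> nat. (\<forall>y. \<psi> y < k2) \<and> (\<forall>y y'. \<psi> y = \<psi> y' \<longrightarrow>
        (\<forall>x\<in>{x. length x = n \<and> set x \<subseteq> {..<a}}. \<chi> x y = \<chi> x y')))"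
    using joint_colouring[OF finite_words] by (rule exE) (rule that)
  have "sorted_wrt (\<le>) bs" using Cons.prems by simp
  from Cons.IH[OF this, of k2] obtain cs where cs: "sorted_over bs cs"
    and ih: "\<forall>\<chi>. (\<forall>w. \<chi> w < k2) \<longrightarrow>
    (\<exists>u. pword a bs cs u \<and>
      (\<forall>x x'. length x = length x' \<and> length x \<le> length bs \<and> set x \<subseteq> {..<a} \<and> set x' \<subseteq> {..<a} \<longrightarrow>
        \<chi> (plug ([0..<a] @ x) (takeWhile (\<lambda>y. y < a + length x) u))
          = (\<chi> (plug ([0..<a] @ x') (takeWhile (\<lambda>y. y < a + length x) u)) :: nat)))"
    by (elim exE conjE) (rule that)
  show ?case
  proof (intro exI[of _ "replicate n b @ cs"] conjI allI impI)
    show "sorted_over (b # bs) (replicate n b @ cs)" by (rule sorted_over_Cons[OF Cons.prems cs])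
    fix \<chi> :: "nat list \<Rightarrow> nat" assume \<chi>: "\<forall>w. \<chi> w < r"
    obtain \<psi> where \<psi>: "\<And>y. \<psi> y < k2" "\<And>y y' x. \<lbrakk>\<psi> y = \<psi> y'; length x = n; set x \<subseteq> {..<a}\<rbrakk>
        \<Longrightarrow> \<chi> (x @ y) = \<chi> (x @ y')"
      using k2[rule_format, of "\<lambda>x y. \<chi> (x @ y)"] \<chi> by auto
    define part where "part u x = plug ([0..<a] @ x) (takeWhile (\<lambda>y. y < a + length x) u)" for u x
    obtain u where u: "pword a bs cs u"
      and u': "\<And>x x'. \<lbrakk>length x = length x'; length x \<le> length bs; set x \<subseteq> {..<a}; set x' \<subseteq> {..<a}\<rbrakk> \<Longrightarrow>
        \<psi> (part u x) = \<psi> (part u x')"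
      using ih[rule_format, of \<psi>] \<psi>(1) unfolding part_def by metis
    obtain \<phi> where \<phi>: "\<And>y. \<phi> y < k" "\<And>y y' j. \<lbrakk>\<phi> y = \<phi> y'; j \<le> length bs\<rbrakk>
        \<Longrightarrow> \<chi> (y @ part u (replicate j 0)) = \<chi> (y' @ part u (replicate j 0))"
      using k[rule_format, of "\<lambda>j y. \<chi> (y @ part u (replicate j 0))"] \<chi> atMost_iff by metis
    obtain e where e: "pword a [b] (replicate n b) e"
      and e': "\<And>x y. \<lbrakk>x < a; y < a\<rbrakk> \<Longrightarrow> \<phi> (plug ([0..<a] @ [x]) e) = \<phi> (plug ([0..<a] @ [y]) e)"
      using n[rule_format, of \<phi>] \<phi>(1) by metis
    define t where "t = e @ widen a (length bs) u"
    show "\<exists>u. pword a (b # bs) (replicate n b @ cs) u \<and>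
      (\<forall>x x'. length x = length x' \<and> length x \<le> length (b # bs) \<and> set x \<subseteq> {..<a} \<and> set x' \<subseteq> {..<a} \<longrightarrow>
        \<chi> (plug ([0..<a] @ x) (takeWhile (\<lambda>y. y < a + length x) u))
          = \<chi> (plug ([0..<a] @ x') (takeWhile (\<lambda>y. y < a + length x) u)))"
    proof (intro exI[of _ t] conjI allI impI)
      show "pword a (b # bs) (replicate n b @ cs) t"
        using pword_append[OF e, of bs cs] pword_widen[OF u] by (simp add: t_def)
      have split: "part t (c # x) = plug ([0..<a] @ [c]) e @ part u x"
        if "length x \<le> length bs" for c x
      proof -
        have "takeWhile (\<lambda>y. y < a + length (c # x)) t
          = e @ takeWhile (\<lambda>y. y < a + length (c # x)) (widen a (length bs) u)"
          unfolding t_def using pword_letters[OF e] by (intro takeWhile_append2) auto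
        also have "takeWhile (\<lambda>y. y < a + length (c # x)) (widen a (length bs) u)
          = widen a (length bs) (takeWhile (\<lambda>y. y < a + length x) u)"
          unfolding takeWhile_map using pword_letters[OF u]
          by (intro arg_cong[of _ _ "map _"] takeWhile_cong refl)
            (auto simp: nth_append simp del: upt_Suc)
        also have "\<dots> = widen a (length x) (takeWhile (\<lambda>y. y < a + length x) u)"
          using that by (auto simp: nth_append simp del: upt_Suc dest!: set_takeWhileD)
        finally have *: "takeWhile (\<lambda>y. y < a + length (c # x)) t =
            e @ widen a (length x) (takeWhile (\<lambda>y. y < a + length x) u)" .
        have "plug (([0..<a] @ [c]) @ x) e = plug ([0..<a] @ [c]) e"
          using pword_letters[OF e] by (intro plug_append1) auto
        moreover have "plug ([0..<a] @ c # x) (widen a (length x) (takeWhile (\<lambda>y. y < a + length x) u))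
            = part u x"
          unfolding part_def by (rule plug_widen) (auto dest!: set_takeWhileD)
        ultimately show ?thesis unfolding part_def[of t] * by simp
      qed
      have colour: "\<chi> (part t (c # x)) = \<chi> (plug ([0..<a] @ [0]) e @ part u (replicate (length x) 0))"
        if "c < a" "length x \<le> length bs" "set x \<subseteq> {..<a}" for c x
      proof -
        have "length (plug ([0..<a] @ [c]) e) = n" "set (plug ([0..<a] @ [c]) e) \<subseteq> {..<a}"
          using pword_length[OF e] pword_letters[OF e] that
          by (auto simp: nth_append split: if_splits)
        then have "\<chi> (part t (c # x)) = \<chi> (plug ([0..<a] @ [c]) e @ part u (replicate (length x) 0))"
          unfolding split[OF that(2)] using that assms(1) by (intro \<psi>(2) u') auto
        also have "\<dots> = \<chi> (plug ([0..<a] @ [0]) e @ part u (replicate (length x) 0))"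
          using that assms(1) by (intro \<phi>(2) e') auto
        finally show ?thesis .
      qed
      fix x x' :: "nat list"
      assume *: "length x = length x' \<and> length x \<le> length (b # bs) \<and> set x \<subseteq> {..<a} \<and> set x' \<subseteq> {..<a}"
      have "\<chi> (part t x) = \<chi> (part t x')"
      proof (cases x)
        case Nil
        then show ?thesis using * by simp
      next
        case (Cons c y)
        moreover obtain c' y' where "x' = c' # y'" using * Cons by (cases x') auto
        ultimately show ?thesis using * by (simp add: colour)
      qed
      then show "\<chi> (plug ([0..<a] @ x) (takeWhile (\<lambda>y. y < a + length x) t))
          = \<chi> (plug ([0..<a] @ x') (takeWhile (\<lambda>y. y < a + length x) t))"
        using * by (simp add: part_def)
    qed
  qed
qed

definition ramsey_words :: "nat \<Rightarrow> 'l list \<Rightarrow> 'l list \<Rightarrow> nat \<Rightarrow> 'l list \<Rightarrow> bool" where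
  "ramsey_words a as bs r cs \<longleftrightarrow> (\<forall>\<chi>. (\<forall>w. \<chi> w < r) \<longrightarrow>
     (\<exists>u. pword a bs cs u \<and> (\<exists>c. \<forall>v. pword a as bs v \<longrightarrow> \<chi> (plug ([0..<a] @ v) u) = c)))"

text \<open>
  Each position of \<open>bs\<close> may hold the first occurrence of the first parameter, and the rest of the
  word is then a word over \<open>a + 1\<close> constants to which the Ramsey hypothesis applies. For the head of
  \<open>bs\<close>, this is applied to the list \<open>cs\<close> that the induction hypothesis provides for the tail: the
  resulting \<open>w\<close> settles all words that begin with the parameter, so that the subsequent choice of
  \<open>u\<close>, for the words that begin with a constant, cannot spoil this.
\<close>

lemma first_parameter_colouring:
  fixes bs :: "'l::order list"
  assumes ramsey: "\<And>(bs :: 'l list) r. sorted_wrt (\<le>) bs \<Longrightarrow> \<exists>cs. sorted_over bs cs \<and> ramsey_words (Suc a) as bs r cs"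
    and "sorted_wrt (\<le>) bs"
  shows "\<exists>cs. sorted_over bs cs \<and> (\<forall>\<chi>. (\<forall>w. \<chi> w < r) \<longrightarrow>
    (\<exists>u. pword a bs cs u \<and>
      (\<forall>v v'. pword a (l # as) bs v \<and> pword a (l # as) bs v' \<and>
          takeWhile (\<lambda>y. y < a) v = takeWhile (\<lambda>y. y < a) v' \<longrightarrow>
        \<chi> (plug ([0..<a] @ v) u) = (\<chi> (plug ([0..<a] @ v') u) :: nat))))"
  using assms(2)
proof (induction bs arbitrary: r)
  case Nil
  show ?case
    by (rule exI[of _ "[]"]) (auto simp: sorted_over_def pword_length dest: pword_length intro!: exI[of _ "[]"])
next
  case (Cons b bs)
  obtain k where k: "\<forall>\<chi>. (\<forall>x y. \<chi> x y < r) \<longrightarrow>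
      (\<exists>\<psi> :: nat list \<Rightarrow> nat. (\<forall>y. \<psi> y < k) \<and> (\<forall>y y'. \<psi> y = \<psi> y' \<longrightarrow>
        (\<forall>x\<in>{..<a}. \<chi> x y = \<chi> x y')))"
    using joint_colouring[of "{..<a}"] by (rule exE[OF _ that]) simp
  have "sorted_wrt (\<le>) bs" using Cons.prems by simp
  from Cons.IH[OF this, of k] obtain cs where cs: "sorted_over bs cs"
    and ih: "\<forall>\<chi>. (\<forall>w. \<chi> w < k) \<longrightarrow>
    (\<exists>u. pword a bs cs u \<and>
      (\<forall>v v'. pword a (l # as) bs v \<and> pword a (l # as) bs v' \<and>
          takeWhile (\<lambda>y. y < a) v = takeWhile (\<lambda>y. y < a) v' \<longrightarrow>
        \<chi> (plug ([0..<a] @ v) u) = (\<chi> (plug ([0..<a] @ v') u) :: nat)))"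
    by (elim exE conjE) (rule that)
  obtain ds where ds: "sorted_over cs ds" "ramsey_words (Suc a) as cs r ds"
    using ramsey cs unfolding sorted_over_def by blast
  show ?case
  proof (intro exI[of _ "b # ds"] conjI allI impI)
    show "sorted_over (b # bs) (b # ds)" using sorted_over_Cons[OF Cons.prems sorted_over_trans[OF cs ds(1)], of 1] by simp
    fix \<chi> :: "nat list \<Rightarrow> nat" assume \<chi>: "\<forall>w. \<chi> w < r"
    obtain w d where w: "pword (Suc a) cs ds w"
      and w': "\<And>v. pword (Suc a) as cs v \<Longrightarrow> \<chi> (a # plug ([0..<Suc a] @ v) w) = d"
      using ds(2)[unfolded ramsey_words_def, rule_format, of "\<lambda>y. \<chi> (a # y)"] \<chi> by metis
    obtain \<psi> where \<psi>: "\<And>y. \<psi> y < k" "\<And>y y' c. \<lbrakk>\<psi> y = \<psi> y'; c < a\<rbrakk>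
        \<Longrightarrow> \<chi> (c # plug ([0..<a] @ c # y) w) = \<chi> (c # plug ([0..<a] @ c # y') w)"
      using k[rule_format, of "\<lambda>c y. \<chi> (c # plug ([0..<a] @ c # y) w)"] \<chi> lessThan_iff by metis
    obtain u where u: "pword a bs cs u"
      and u': "\<And>v v'. \<lbrakk>pword a (l # as) bs v; pword a (l # as) bs v';
          takeWhile (\<lambda>y. y < a) v = takeWhile (\<lambda>y. y < a) v'\<rbrakk> \<Longrightarrow>
        \<psi> (plug ([0..<a] @ v) u) = \<psi> (plug ([0..<a] @ v') u)"
      using ih[rule_format, of \<psi>] \<psi>(1) by blast
    define t where "t = a # plug ([0..<Suc a] @ widen a (length bs) u) w"
    have t_sub: "plug ([0..<a] @ c # v) t = c # plug ([0..<a] @ c # plug ([0..<a] @ v) u) w"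
      if "length v = length bs" for c v
    proof -
      have "plug (([0..<a] @ [c]) @ v) (plug ([0..<Suc a] @ widen a (length bs) u) w)
          = plug (([0..<a] @ [c]) @ plug (([0..<a] @ [c]) @ v) (widen a (length bs) u)) w"
        by (rule plug_plug_alphabet[OF w]) (simp_all add: pword_length[OF u])
      moreover have "plug ([0..<a] @ c # v) (widen a (length bs) u) = plug ([0..<a] @ v) u"
        using plug_widen[of u a v "[0..<a]" c] pword_letters[OF u] that by simp
      moreover have "plug ([0..<a] @ c # v) t
          = c # plug (([0..<a] @ [c]) @ v) (plug ([0..<Suc a] @ widen a (length bs) u) w)"
        using nth_append_length[of "[0..<a]" c v] unfolding t_def by (simp del: upt_Suc)
      ultimately show ?thesis by (simp only: append_assoc append_Cons append_Nil)
    qed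
    show "\<exists>u. pword a (b # bs) (b # ds) u \<and>
      (\<forall>v v'. pword a (l # as) (b # bs) v \<and> pword a (l # as) (b # bs) v' \<and>
          takeWhile (\<lambda>y. y < a) v = takeWhile (\<lambda>y. y < a) v' \<longrightarrow>
        \<chi> (plug ([0..<a] @ v) u) = \<chi> (plug ([0..<a] @ v') u))"
    proof (intro exI[of _ t] conjI allI impI)
      show "pword a (b # bs) (b # ds) t"
        using pword_plug_alphabet[OF w pword_widen[OF u]] by (simp add: t_def)
      have first: "\<chi> (plug ([0..<a] @ a # y) t) = d" if "pword (Suc a) as bs y" for y
      proof -
        have "pword (Suc a) as cs (plug ([0..<a] @ y) u)"
          by (rule pword_plug[OF u that]) auto
        then show ?thesis using t_sub[of y a] pword_length[OF that] w' by simp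
      qed
      fix v v' :: "nat list"
      assume *: "pword a (l # as) (b # bs) v \<and> pword a (l # as) (b # bs) v' \<and>
          takeWhile (\<lambda>y. y < a) v = takeWhile (\<lambda>y. y < a) v'"
      then obtain c y c' y' where v: "v = c # y" "v' = c' # y'" by (cases v; cases v') auto
      show "\<chi> (plug ([0..<a] @ v) t) = \<chi> (plug ([0..<a] @ v') t)"
      proof (cases "c < a")
        case True
        with * v have 1: "c' = c" "pword a (l # as) bs y" "pword a (l # as) bs y'"
          "takeWhile (\<lambda>y. y < a) y = takeWhile (\<lambda>y. y < a) y'" by (auto split: if_splits)
        then have "\<psi> (plug ([0..<a] @ y) u) = \<psi> (plug ([0..<a] @ y') u)" by (intro u')
        then show ?thesis using True v 1 t_sub[of y c] t_sub[of y' c] \<psi>(2) pword_length by metis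
      next
        case False
        with * v have "c = a" "c' = a" "pword (Suc a) as bs y" "pword (Suc a) as bs y'"
          by (auto split: if_splits)
        then show ?thesis using v first by simp
      qed
    qed
  qed
qed

text \<open>
  The part of a composite before its first parameter is determined by the same part \<open>x\<close> of \<open>v\<close>: the
  first parameter of the composite appears where \<open>u\<close> has the first occurrence of its parameter
  with number \<open>length x\<close>.
\<close>

lemma takeWhile_plug:
  assumes "pword a bs cs u" "length v = length bs" "length s = a" "set s \<subseteq> {..<a'}"
  shows "takeWhile (\<lambda>y. y < a') (plug (s @ v) u) =
    plug (s @ takeWhile (\<lambda>y. y < a') v)
      (takeWhile (\<lambda>y. y < a + length (takeWhile (\<lambda>y. y < a') v)) u)"
  using assms
proof (induction a bs cs u arbitrary: v s rule: pword.induct)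
  case (2 a bs c cs x u)
  show ?case
  proof (cases "x < a")
    case True
    then have "s ! x < a'" using 2 by (metis lessThan_iff nth_mem subsetD)
    then show ?thesis using 2 True by (auto simp: nth_append)
  next
    case False
    then obtain bs' where bs: "x = a" "bs = c # bs'" "pword (Suc a) bs' cs u" using 2 by auto
    then obtain y v' where v: "v = y # v'" using 2 by (cases v) auto
    have new [simp]: "(s @ y # z) ! a = y" for z using "2.prems"(3) by auto
    show ?thesis
    proof (cases "y < a'")
      case True
      have "takeWhile (\<lambda>y. y < a') (plug ((s @ [y]) @ v') u) =
        plug ((s @ [y]) @ takeWhile (\<lambda>y. y < a') v')
          (takeWhile (\<lambda>y. y < Suc a + length (takeWhile (\<lambda>y. y < a') v')) u)"
        by (rule "2.IH"(2)) (use 2 bs v True in auto)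
      then show ?thesis using bs v True "2.prems" by simp
    next
      case False
      then show ?thesis using bs v "2.prems" by simp
    qed
  qed
qed auto

lemma first_parameter_position:
  assumes "pword a (l # as) bs v"
  shows "length (takeWhile (\<lambda>y. y < a) v) < length bs"
    and "bs ! length (takeWhile (\<lambda>y. y < a) v) = l"
  using assms by (induction a "l # as" bs v rule: pword.induct) auto

text \<open>
  The parameters are introduced at the first \<open>t\<close> positions with property \<open>P\<close>; all other positions
  get the constant \<open>0\<close>.
\<close>

lemma pword_choose_positions:
  assumes "0 < a" "t \<le> (\<Sum>i<n. if P i then 1 else 0)"
  shows "\<exists>u. pword a (replicate t l) (replicate n l) u \<and>
    (\<forall>j<t. P (length (takeWhile (\<lambda>y. y < a + j) u)))"
  using assms
proof (induction n arbitrary: a t P)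
  case 0
  then show ?case by (auto intro!: exI[of _ "[]"])
next
  case (Suc n)
  have sum: "(\<Sum>i<Suc n. if P i then 1 else 0) =
      (if P 0 then 1 else 0) + (\<Sum>i<n. if P (Suc i) then 1 else 0 :: nat)"
    by (rule sum.lessThan_Suc_shift)
  show ?case
  proof (cases "P 0 \<and> 0 < t")
    case True
    then obtain t' where t: "t = Suc t'" using gr0_implies_Suc by blast
    have "t' \<le> (\<Sum>i<n. if P (Suc i) then 1 else 0)" using Suc.prems(2) sum True t by simp
    from Suc.IH[of "Suc a", OF _ this] obtain u where
      u: "pword (Suc a) (replicate t' l) (replicate n l) u"
        "\<forall>j<t'. P (Suc (length (takeWhile (\<lambda>y. y < Suc a + j) u)))" by auto
    have "P (length (takeWhile (\<lambda>y. y < a + j) (a # u)))" if "j < t" for j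
      using that True u(2) t by (cases j) auto
    then show ?thesis using u(1) t by (intro exI[of _ "a # u"]) auto
  next
    case False
    have "t \<le> (\<Sum>i<n. if P (Suc i) then 1 else 0)" using Suc.prems(2) sum False by (cases "t = 0") auto
    from Suc.IH[OF Suc.prems(1) this] obtain u where
      u: "pword a (replicate t l) (replicate n l) u"
        "\<forall>j<t. P (Suc (length (takeWhile (\<lambda>y. y < a + j) u)))" by auto
    then show ?thesis using Suc.prems(1) by (intro exI[of _ "0 # u"]) auto
  qed
qed

lemma frequent_colour:
  fixes g :: "nat \<Rightarrow> nat"
  assumes "\<And>i. g i < r"
  shows "\<exists>c. t \<le> (\<Sum>i<r * t. if g i = c then 1 else 0 :: nat)"
proof (rule ccontr)
  assume "\<not> ?thesis"
  then have less: "(\<Sum>i<r * t. if g i = c then 1 else 0) < t" for c by (simp add: not_le)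
  have "r * t = (\<Sum>i<r * t. \<Sum>c<r. if g i = c then 1 else 0)"
    using assms by (simp add: sum.delta')
  also have "\<dots> = (\<Sum>c<r. \<Sum>i<r * t. if g i = c then 1 else 0)"
    by (rule sum.swap)
  also have "\<dots> < (\<Sum>c<r. t)"
    using assms[of 0] less by (intro sum_strict_mono) auto
  finally show False by simp
qed

text \<open>
  The block of positions of level \<open>l\<close> is lengthened by the factor \<open>r\<close>, so that sufficiently many of them
  have the same colour. Since \<open>bs\<close> is sorted, there is only one block.
\<close>

lemma level_pigeonhole:
  fixes bs :: "'l::order list"
  assumes "0 < a" "sorted_wrt (\<le>) bs"
  shows "\<exists>cs. sorted_over bs cs \<and> (\<forall>g. (\<forall>i. g i < (r::nat)) \<longrightarrow>
    (\<exists>u c. pword a bs cs u \<and>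
      (\<forall>j<length bs. bs ! j = l \<longrightarrow> g (length (takeWhile (\<lambda>y. y < a + j) u)) = c)))"
  using assms
proof (induction bs arbitrary: a)
  case Nil
  show ?case by (rule exI[of _ "[]"]) (auto simp: sorted_over_def intro!: exI[of _ "[]"])
next
  case (Cons b bs)
  show ?case
  proof (cases "b = l")
    case False
    have "0 < Suc a" "sorted_wrt (\<le>) bs" using Cons.prems by auto
    from Cons.IH[OF this] obtain cs where cs: "sorted_over bs cs" and
      cs': "\<And>g. (\<forall>i. g i < r) \<Longrightarrow> \<exists>u c. pword (Suc a) bs cs u \<and>
        (\<forall>j<length bs. bs ! j = l \<longrightarrow> g (length (takeWhile (\<lambda>y. y < Suc a + j) u)) = c)" by blast
    show ?thesis
    proof (intro exI[of _ "b # cs"] conjI allI impI)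
      show "sorted_over (b # bs) (b # cs)" using sorted_over_Cons[OF Cons.prems(2) cs, of 1] by simp
      fix g :: "nat \<Rightarrow> nat" assume "\<forall>i. g i < r"
      then obtain u c where u: "pword (Suc a) bs cs u"
        "\<forall>j<length bs. bs ! j = l \<longrightarrow> g (Suc (length (takeWhile (\<lambda>y. y < Suc a + j) u))) = c"
        using cs'[of "\<lambda>i. g (Suc i)"] by auto
      have "g (length (takeWhile (\<lambda>y. y < a + j) (a # u))) = c"
        if "j < length (b # bs)" "(b # bs) ! j = l" for j
        using that u(2) False by (cases j) auto
      then show "\<exists>u c. pword a (b # bs) (b # cs) u \<and>
          (\<forall>j<length (b # bs). (b # bs) ! j = l \<longrightarrow> g (length (takeWhile (\<lambda>y. y < a + j) u)) = c)"
        using u(1) by (intro exI[of _ "a # u"] exI[of _ c]) auto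
    qed
  next
    case True
    define s where "s = dropWhile (\<lambda>x. x = l) (b # bs)"
    define t where "t = length (takeWhile (\<lambda>x. x = l) (b # bs))"
    have bs: "b # bs = replicate t l @ s"
    proof -
      have "replicate t l = takeWhile (\<lambda>x. x = l) (b # bs)"
        unfolding t_def by (rule replicate_eqI[symmetric]) (auto dest: set_takeWhileD)
      then show ?thesis unfolding s_def by (metis takeWhile_dropWhile_id)
    qed
    have "l \<notin> set s"
    proof (cases s)
      case (Cons x s')
      then have "x \<noteq> l" using hd_dropWhile[of "\<lambda>x. x = l" "b # bs"] unfolding s_def by auto
      moreover have "sorted_wrt (\<le>) (x # s')" "l \<le> x"
        using Cons.prems(2)[unfolded bs] Cons True t_def by (auto simp: sorted_wrt_append)
      ultimately show ?thesis using Cons by auto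
    qed simp
    show ?thesis
    proof (intro exI[of _ "replicate (r * t) l @ s"] conjI allI impI)
      show "sorted_over (b # bs) (replicate (r * t) l @ s)"
        using Cons.prems(2)[unfolded bs] True t_def unfolding bs
        by (auto simp: sorted_over_def sorted_wrt_append sorted_replicate)
      fix g :: "nat \<Rightarrow> nat" assume "\<forall>i. g i < r"
      then obtain c where "t \<le> (\<Sum>i<r * t. if g i = c then 1 else 0 :: nat)"
        using frequent_colour by blast
      from pword_choose_positions[OF Cons.prems(1) this, of l] obtain u where
        u: "pword a (replicate t l) (replicate (r * t) l) u"
          "\<And>j. j < t \<Longrightarrow> g (length (takeWhile (\<lambda>y. y < a + j) u)) = c" by blast
      let ?w = "u @ [a + t..<a + t + length s]"
      have "g (length (takeWhile (\<lambda>y. y < a + j) ?w)) = c"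
        if "j < length (b # bs)" "(b # bs) ! j = l" for j
      proof -
        have "j < t" using that \<open>l \<notin> set s\<close> unfolding bs
          by (metis (no_types) length_append length_replicate nat_add_left_cancel_less nth_append
              nth_mem not_less le_add_diff_inverse)
        moreover have "takeWhile (\<lambda>y. y < a + j) ?w = takeWhile (\<lambda>y. y < a + j) u"
          using \<open>j < t\<close> by (cases "length s") (auto simp: takeWhile_append upt_conv_Cons takeWhile_eq_all_conv[THEN iffD2] simp del: upt_Suc)
        ultimately show ?thesis using u(2) by simp
      qed
      moreover have "pword a (b # bs) (replicate (r * t) l @ s) ?w"
        using pword_append[OF u(1), of s s] pword_identity[of "a + t" s] unfolding bs by simp
      ultimately show "\<exists>u c. pword a (b # bs) (replicate (r * t) l @ s) u \<and>
          (\<forall>j<length (b # bs). (b # bs) ! j = l \<longrightarrow> g (length (takeWhile (\<lambda>y. y < a + j) u)) = c)"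
        by blast
    qed
  qed
qed

text \<open>
  The Graham--Rothschild theorem with levels. The three reductions are composed: \<open>u\<close> removes the
  dependence on the part after the first parameter, \<open>t\<close> that on the letters before it, and \<open>s\<close> that
  on its position.
\<close>

theorem parameter_word_ramsey:
  fixes as bs :: "'l::order list"
  assumes "0 < a" "sorted_wrt (\<le>) bs"
  shows "\<exists>cs. sorted_over bs cs \<and> ramsey_words a as bs r cs"
  using assms
proof (induction as arbitrary: a bs r)
  case Nil
  obtain cs where "sorted_over bs cs" and cs: "\<forall>\<chi>. (\<forall>w. \<chi> w < r) \<longrightarrow>
    (\<exists>u. pword a bs cs u \<and>
      (\<forall>x x'. length x = length x' \<and> length x \<le> length bs \<and> set x \<subseteq> {..<a} \<and> set x' \<subseteq> {..<a} \<longrightarrow>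
        \<chi> (plug ([0..<a] @ x) (takeWhile (\<lambda>y. y < a + length x) u))
          = (\<chi> (plug ([0..<a] @ x') (takeWhile (\<lambda>y. y < a + length x) u)) :: nat)))"
    using prefix_colouring[OF Nil, where r = r] by (elim exE conjE) (rule that)
  moreover have "ramsey_words a [] bs r cs"
    unfolding ramsey_words_def
  proof (intro allI impI)
    fix \<chi> :: "nat list \<Rightarrow> nat" assume \<chi>: "\<forall>w. \<chi> w < r"
    then obtain u where u: "pword a bs cs u"
      and u': "\<And>x x'. \<lbrakk>length x = length x'; length x \<le> length bs; set x \<subseteq> {..<a}; set x' \<subseteq> {..<a}\<rbrakk> \<Longrightarrow>
        \<chi> (plug ([0..<a] @ x) (takeWhile (\<lambda>y. y < a + length x) u))
          = \<chi> (plug ([0..<a] @ x') (takeWhile (\<lambda>y. y < a + length x) u))"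
      using cs[rule_format, of \<chi>] by metis
    have all: "takeWhile (\<lambda>y. y < a + length bs) u = u"
      using pword_letters[OF u] by (auto simp: takeWhile_eq_all_conv)
    have "\<chi> (plug ([0..<a] @ v) u) = \<chi> (plug ([0..<a] @ replicate (length bs) 0) u)"
      if "pword a [] bs v" for v
    proof -
      have v: "length v = length bs" "set v \<subseteq> {..<a}" using that by (auto simp: pword_no_parameters)
      have "set (replicate (length bs) 0) \<subseteq> {..<a}" using Nil(1) by auto
      with u'[of v "replicate (length bs) 0"] v show ?thesis by (simp only: length_replicate all)
    qed
    then show "\<exists>u. pword a bs cs u \<and> (\<exists>c. \<forall>v. pword a [] bs v \<longrightarrow> \<chi> (plug ([0..<a] @ v) u) = c)"
      using u by blast
  qed
  ultimately show ?case by blast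
next
  case (Cons l as)
  have pos: "0 < Suc a" by simp
  obtain cs where cs: "sorted_over bs cs" and P: "\<forall>g. (\<forall>i. g i < r) \<longrightarrow>
    (\<exists>u c. pword a bs cs u \<and>
      (\<forall>j<length bs. bs ! j = l \<longrightarrow> g (length (takeWhile (\<lambda>y. y < a + j) u)) = c))"
    using level_pigeonhole[OF Cons.prems, where r = r and l = l] by (elim exE conjE) (rule that)
  have "sorted_wrt (\<le>) cs" using cs by (simp add: sorted_over_def)
  from prefix_colouring[OF Cons.prems(1) this, where r = r]
  obtain ds where ds: "sorted_over cs ds" and D: "\<forall>\<chi>. (\<forall>w. \<chi> w < r) \<longrightarrow>
    (\<exists>u. pword a cs ds u \<and>
      (\<forall>x x'. length x = length x' \<and> length x \<le> length cs \<and> set x \<subseteq> {..<a} \<and> set x' \<subseteq> {..<a} \<longrightarrow>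
        \<chi> (plug ([0..<a] @ x) (takeWhile (\<lambda>y. y < a + length x) u))
          = (\<chi> (plug ([0..<a] @ x') (takeWhile (\<lambda>y. y < a + length x) u)) :: nat)))"
    by (elim exE conjE) (rule that)
  have "sorted_wrt (\<le>) ds" using ds by (simp add: sorted_over_def)
  moreover have "\<exists>cs. sorted_over bs' cs \<and> ramsey_words (Suc a) as bs' r' cs" if "sorted_wrt (\<le>) bs'" for bs' r'
    using Cons.IH[OF pos that] .
  ultimately have "\<exists>es. sorted_over ds es \<and> (\<forall>\<chi>. (\<forall>w. \<chi> w < r) \<longrightarrow>
    (\<exists>u. pword a ds es u \<and>
      (\<forall>v v'. pword a (l # as) ds v \<and> pword a (l # as) ds v' \<and>
          takeWhile (\<lambda>y. y < a) v = takeWhile (\<lambda>y. y < a) v' \<longrightarrow>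
        \<chi> (plug ([0..<a] @ v) u) = (\<chi> (plug ([0..<a] @ v') u) :: nat))))"
    by (intro first_parameter_colouring)
  then
  obtain es where es: "sorted_over ds es" and E: "\<forall>\<chi>. (\<forall>w. \<chi> w < r) \<longrightarrow>
    (\<exists>u. pword a ds es u \<and>
      (\<forall>v v'. pword a (l # as) ds v \<and> pword a (l # as) ds v' \<and>
          takeWhile (\<lambda>y. y < a) v = takeWhile (\<lambda>y. y < a) v' \<longrightarrow>
        \<chi> (plug ([0..<a] @ v) u) = (\<chi> (plug ([0..<a] @ v') u) :: nat)))"
    by (elim exE conjE) (rule that)
  have "ramsey_words a (l # as) bs r es"
    unfolding ramsey_words_def
  proof (intro allI impI)
    fix \<chi> :: "nat list \<Rightarrow> nat" assume \<chi>: "\<forall>w. \<chi> w < r"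
    obtain u where u: "pword a ds es u"
      and u': "\<And>v v'. \<lbrakk>pword a (l # as) ds v; pword a (l # as) ds v';
          takeWhile (\<lambda>y. y < a) v = takeWhile (\<lambda>y. y < a) v'\<rbrakk> \<Longrightarrow>
        \<chi> (plug ([0..<a] @ v) u) = \<chi> (plug ([0..<a] @ v') u)"
      using E[rule_format, of \<chi>] \<chi> by blast
    have "\<exists>h. (\<forall>x. h x < r) \<and> (\<forall>v. pword a (l # as) ds v \<longrightarrow>
        \<chi> (plug ([0..<a] @ v) u) = h (takeWhile (\<lambda>y. y < a) v))"
    proof (rule colouring_factors)
      show "\<chi> (plug ([0..<a] @ v) u) < r" for v using \<chi> by simp
    qed (rule u')
    then obtain h where h: "\<forall>x. h x < r" and hv: "\<forall>v. pword a (l # as) ds v \<longrightarrow>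
        \<chi> (plug ([0..<a] @ v) u) = h (takeWhile (\<lambda>y. y < a) v)"
      by (elim exE conjE) (rule that)
    obtain t where t: "pword a cs ds t"
      and t': "\<And>x x'. \<lbrakk>length x = length x'; length x \<le> length cs; set x \<subseteq> {..<a}; set x' \<subseteq> {..<a}\<rbrakk> \<Longrightarrow>
        h (plug ([0..<a] @ x) (takeWhile (\<lambda>y. y < a + length x) t))
          = h (plug ([0..<a] @ x') (takeWhile (\<lambda>y. y < a + length x) t))"
      using D[rule_format, of h] h by metis
    have "\<exists>g. (\<forall>i. g i < r) \<and> (\<forall>x. length x \<le> length cs \<and> set x \<subseteq> {..<a} \<longrightarrow>
        h (plug ([0..<a] @ x) (takeWhile (\<lambda>y. y < a + length x) t)) = g (length x))"
    proof (rule colouring_factors)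
      fix x y :: "nat list"
      assume "length x \<le> length cs \<and> set x \<subseteq> {..<a}" "length y \<le> length cs \<and> set y \<subseteq> {..<a}"
        and len: "length x = length y"
      then show "h (plug ([0..<a] @ x) (takeWhile (\<lambda>z. z < a + length x) t))
          = h (plug ([0..<a] @ y) (takeWhile (\<lambda>z. z < a + length y) t))"
        using t'[of x y] by (simp only: len)
    qed (use h in simp)
    then obtain g where g: "\<forall>i. g i < r" and gx: "\<forall>x. length x \<le> length cs \<and> set x \<subseteq> {..<a} \<longrightarrow>
        h (plug ([0..<a] @ x) (takeWhile (\<lambda>y. y < a + length x) t)) = g (length x)"
      by (elim exE conjE) (rule that)
    obtain s c where s: "pword a bs cs s"
      and s': "\<And>j. \<lbrakk>j < length bs; bs ! j = l\<rbrakk> \<Longrightarrow> g (length (takeWhile (\<lambda>y. y < a + j) s)) = c"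
      using P[rule_format, of g] g by blast
    let ?u = "plug ([0..<a] @ plug ([0..<a] @ s) t) u"
    have "\<chi> (plug ([0..<a] @ v) ?u) = c" if v: "pword a (l # as) bs v" for v
    proof -
      define w where "w = plug ([0..<a] @ v) s"
      define x where "x = takeWhile (\<lambda>y. y < a) w"
      have w: "pword a (l # as) cs w" unfolding w_def by (rule pword_plug_alphabet[OF s v])
      have wt: "pword a (l # as) ds (plug ([0..<a] @ w) t)" by (rule pword_plug_alphabet[OF t w])
      have "plug ([0..<a] @ v) ?u = plug ([0..<a] @ plug ([0..<a] @ v) (plug ([0..<a] @ s) t)) u"
        by (rule plug_plug_alphabet[OF u]) (simp_all add: pword_length[OF t])
      also have "plug ([0..<a] @ v) (plug ([0..<a] @ s) t) = plug ([0..<a] @ w) t"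
        unfolding w_def by (rule plug_plug_alphabet[OF t]) (simp_all add: pword_length[OF s])
      finally have "\<chi> (plug ([0..<a] @ v) ?u) = h (takeWhile (\<lambda>y. y < a) (plug ([0..<a] @ w) t))"
        using hv[rule_format, OF wt] by (simp only:)
      also have "takeWhile (\<lambda>y. y < a) (plug ([0..<a] @ w) t)
          = plug ([0..<a] @ x) (takeWhile (\<lambda>y. y < a + length x) t)"
        unfolding x_def by (rule takeWhile_plug[OF t]) (auto simp: pword_length[OF w])
      also have "h \<dots> = g (length x)"
        by (rule gx[rule_format]) (use first_parameter_position(1)[OF w] in \<open>auto simp: x_def dest: set_takeWhileD\<close>)
      also have "length x = length (takeWhile (\<lambda>y. y < a + length (takeWhile (\<lambda>y. y < a) v)) s)"
        unfolding x_def w_def by (subst takeWhile_plug[OF s]) (auto simp: pword_length[OF v])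
      also have "g \<dots> = c"
        by (rule s'[OF first_parameter_position[OF v]])
      finally show ?thesis .
    qed
    moreover have "pword a bs es ?u"
      by (intro pword_plug_alphabet[OF u] pword_plug_alphabet[OF t] s)
    ultimately show "\<exists>u. pword a bs es u \<and>
        (\<exists>c. \<forall>v. pword a (l # as) bs v \<longrightarrow> \<chi> (plug ([0..<a] @ v) u) = c)" by blast
  qed
  then show ?case using sorted_over_trans[OF sorted_over_trans[OF cs ds] es] by blast
qed

section \<open>Finite Boolean algebras and their atoms\<close>

context boolean_algebra_structure
begin

lemma meet_zero:
  assumes "x \<in> univ A"
  shows "meet A x (zero A) = zero A"
proof -
  have "meet A x (zero A) = join A (meet A x (zero A)) (meet A x (compl A x))"
    using assms by (simp add: meet_compl join_zero meet_closed zero_closed)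
  also have "\<dots> = meet A x (join A (zero A) (compl A x))"
    using assms by (simp add: meet_join_distrib zero_closed compl_closed)
  also have "join A (zero A) (compl A x) = compl A x"
    using assms join_commute join_zero zero_closed compl_closed by metis
  finally show ?thesis using assms by (simp add: meet_compl)
qed

lemma meet_idem:
  assumes "x \<in> univ A"
  shows "meet A x x = x"
proof -
  have "meet A x x = join A (meet A x x) (meet A x (compl A x))"
    using assms by (simp add: meet_compl join_zero meet_closed)
  also have "\<dots> = meet A x (join A x (compl A x))"
    using assms by (simp add: meet_join_distrib compl_closed)
  finally show ?thesis using assms by (simp add: join_compl meet_one)
qed

lemma atom_closed: "a \<in> atoms A \<Longrightarrow> a \<in> univ A"
  by (simp add: atoms_def)

lemma meet_atom:
  assumes "a \<in> atoms A" "x \<in> univ A"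
  shows "meet A a x = (if below A a x then a else zero A)"
proof -
  have a: "a \<in> univ A" using assms by (simp add: atoms_def)
  have "meet A (meet A a x) a = meet A a x"
    using a assms(2) meet_assoc meet_commute meet_idem meet_closed by metis
  then show ?thesis
    using assms meet_closed[OF a assms(2)] unfolding atoms_def below_def by auto
qed

lemma atom_below_join:
  assumes "a \<in> atoms A" "x \<in> univ A" "y \<in> univ A"
  shows "below A a (join A x y) \<longleftrightarrow> below A a x \<or> below A a y"
proof -
  have a: "a \<in> univ A" "a \<noteq> zero A" using assms by (auto simp: atoms_def)
  have "meet A a (join A x y) = join A (meet A a x) (meet A a y)"
    using a assms by (simp add: meet_join_distrib)
  moreover have "join A a a = a"
    using a join_meet_distrib[of a a "zero A"] join_zero meet_compl join_compl
      join_meet_distrib[of a a "compl A a"] meet_one[of "join A a a"] join_closed compl_closed by simp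
  moreover have "join A (zero A) a = a"
    using a join_zero join_commute zero_closed by metis
  ultimately show ?thesis
    using assms a meet_atom[of a x] meet_atom[of a y] unfolding below_def
    by (auto simp: join_zero zero_closed split: if_splits)
qed

lemma atom_below_meet:
  assumes "a \<in> atoms A" "x \<in> univ A" "y \<in> univ A"
  shows "below A a (meet A x y) \<longleftrightarrow> below A a x \<and> below A a y"
proof -
  have a: "a \<in> univ A" "a \<noteq> zero A" using assms by (auto simp: atoms_def)
  have "meet A a (meet A x y) = meet A (meet A a x) y"
    using a assms by (simp add: meet_assoc)
  moreover have "meet A (zero A) y = zero A"
    using assms meet_zero meet_commute zero_closed by metis
  ultimately show ?thesis
    using assms a meet_atom[of a x] meet_atom[of a y] unfolding below_def
    by (auto split: if_splits)
qed

lemma atom_below_zero: "a \<in> atoms A \<Longrightarrow> \<not> below A a (zero A)"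
  by (auto simp: below_def atoms_def meet_zero)

lemma atom_below_one: "a \<in> atoms A \<Longrightarrow> below A a (one A)"
  by (simp add: below_def atoms_def meet_one)

lemma atom_below_compl:
  assumes "a \<in> atoms A" "x \<in> univ A"
  shows "below A a (compl A x) \<longleftrightarrow> \<not> below A a x"
  using atom_below_join[OF assms compl_closed[OF assms(2)]]
    atom_below_meet[OF assms compl_closed[OF assms(2)]] assms
  by (auto simp: join_compl meet_compl atom_below_zero atom_below_one)

lemma atom_below_atom: "a \<in> atoms A \<Longrightarrow> b \<in> atoms A \<Longrightarrow> below A a b \<longleftrightarrow> a = b"
  by (auto simp: atoms_def below_def meet_idem)

lemma ex_atom_below:
  assumes "finite (univ A)" "x \<in> univ A" "x \<noteq> zero A"
  shows "\<exists>a\<in>atoms A. below A a x"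
  using assms(2,3)
proof (induction "card {y \<in> univ A. below A y x}" arbitrary: x rule: less_induct)
  case less
  show ?case
  proof (cases "x \<in> atoms A")
    case True
    then show ?thesis using atom_below_atom by blast
  next
    case False
    then obtain y where y: "y \<in> univ A" "below A y x" "y \<noteq> zero A" "y \<noteq> x"
      using less.prems unfolding atoms_def by blast
    have trans: "below A z x" if "z \<in> univ A" "below A z y" for z
      using that y less.prems meet_assoc unfolding below_def by metis
    have "\<not> below A x y" using y less.prems meet_commute unfolding below_def by metis
    then have "{z \<in> univ A. below A z y} \<subset> {z \<in> univ A. below A z x}"
      using trans less.prems meet_idem unfolding below_def by blast
    then have "card {z \<in> univ A. below A z y} < card {z \<in> univ A. below A z x}"
      using assms(1) by (intro psubset_card_mono) auto
    from less.hyps[OF this y(1,3)] show ?thesis using trans atom_closed by blast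
  qed
qed

lemma eq_if_same_atoms:
  assumes "finite (univ A)" "x \<in> univ A" "y \<in> univ A"
    and same: "\<And>a. a \<in> atoms A \<Longrightarrow> below A a x \<longleftrightarrow> below A a y"
  shows "x = y"
proof -
  have below: "meet A x y = x"
    if "x \<in> univ A" "y \<in> univ A" "\<And>a. a \<in> atoms A \<Longrightarrow> below A a x \<longleftrightarrow> below A a y" for x y
  proof -
    have "meet A x (compl A y) = zero A"
      using ex_atom_below[OF assms(1), of "meet A x (compl A y)"] that
      by (auto simp: meet_closed compl_closed atom_below_meet atom_below_compl)
    moreover have "x = join A (meet A x y) (meet A x (compl A y))"
      using that meet_join_distrib[of x y "compl A y"] by (simp add: join_compl compl_closed meet_one)
    ultimately show ?thesis using that by (simp add: join_zero meet_closed)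
  qed
  show ?thesis using below[of x y] below[of y x] assms meet_commute by metis
qed

text \<open>
  The join is built one atom at a time, which also shows that it lies in every ideal that contains
  the atoms.
\<close>

lemma ex_join_of_atoms:
  assumes "finite T" "T \<subseteq> atoms A"
  shows "\<exists>x\<in>univ A. (\<forall>a\<in>atoms A. below A a x \<longleftrightarrow> a \<in> T) \<and> (\<forall>I. nontrivial_ideal A I \<and> T \<subseteq> I \<longrightarrow> x \<in> I)"
  using assms
proof (induction T)
  case empty
  then show ?case
    by (intro bexI[of _ "zero A"]) (auto simp: atom_below_zero zero_closed nontrivial_ideal_def)
next
  case (insert b T)
  then obtain x where x: "x \<in> univ A" "\<forall>a\<in>atoms A. below A a x \<longleftrightarrow> a \<in> T"
    "\<forall>I. nontrivial_ideal A I \<and> T \<subseteq> I \<longrightarrow> x \<in> I" by auto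
  show ?case
    using x insert.prems atom_closed
    by (intro bexI[of _ "join A b x"])
      (auto simp: atom_below_join atom_below_atom join_closed, auto simp: nontrivial_ideal_def)
qed

lemma ideal_determined_by_atoms:
  assumes "finite (univ A)" "nontrivial_ideal A I" "x \<in> univ A"
  shows "x \<in> I \<longleftrightarrow> (\<forall>a\<in>atoms A. below A a x \<longrightarrow> a \<in> I)"
proof
  assume "x \<in> I"
  then show "\<forall>a\<in>atoms A. below A a x \<longrightarrow> a \<in> I"
    using assms(2) atom_closed unfolding nontrivial_ideal_def by blast
next
  assume *: "\<forall>a\<in>atoms A. below A a x \<longrightarrow> a \<in> I"
  let ?T = "{a \<in> atoms A. below A a x}"
  have "finite ?T" using assms(1) by (simp add: atoms_def)
  from ex_join_of_atoms[OF this] obtain y where y: "y \<in> univ A" "\<forall>a\<in>atoms A. below A a y \<longleftrightarrow> a \<in> ?T"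
    "\<forall>I. nontrivial_ideal A I \<and> ?T \<subseteq> I \<longrightarrow> y \<in> I" by auto
  have "x = y" using y assms by (intro eq_if_same_atoms) auto
  moreover have "y \<in> I" using y(3) assms(2) * by blast
  ultimately show "x \<in> I" by simp
qed

end

section \<open>Natural orderings and lists of levels\<close>

lemma strict_linear_order_enumeration:
  assumes "finite S" "strict_linear_order_on S s"
  shows "\<exists>xs. set xs = S \<and> sorted_wrt (\<lambda>x y. (y, x) \<in> s) xs"
  using assms
proof (induction S)
  case (insert x S)
  have "strict_linear_order_on S s"
    using insert.prems unfolding strict_linear_order_on_def by (auto simp: total_on_def)
  from insert.IH[OF this] obtain xs where xs: "set xs = S" "sorted_wrt (\<lambda>x y. (y, x) \<in> s) xs"
    by blast
  have s: "trans s" "\<And>y. y \<in> S \<Longrightarrow> (x, y) \<in> s \<or> (y, x) \<in> s"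
    using insert.prems insert.hyps unfolding strict_linear_order_on_def total_on_def by (blast, metis insertCI)
  have "sorted_wrt (\<lambda>x y. (y, x) \<in> s) (filter (\<lambda>y. (x, y) \<in> s) xs @ x # filter (\<lambda>y. (y, x) \<in> s) xs)"
    using xs(2) s(1) by (auto simp: sorted_wrt_append sorted_wrt_filter dest: transD)
  moreover have "set (filter (\<lambda>y. (x, y) \<in> s) xs @ x # filter (\<lambda>y. (y, x) \<in> s) xs) = insert x S"
    using xs(1) s(2) by auto
  ultimately show ?case by blast
qed auto

text \<open>
  The antilexicographic order for atoms listed from the largest to the smallest: the largest atom
  on which two elements differ has the smallest index.
\<close>

definition first_difference_in :: "nat set \<Rightarrow> nat set \<Rightarrow> bool" where
  "first_difference_in X Y \<longleftrightarrow> (\<exists>i\<in>Y - X. \<forall>i'<i. i' \<in> X \<longleftrightarrow> i' \<in> Y)"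

text \<open>
  The structure on the subsets of \<open>{..<n}\<close> in which \<open>Ls ! i\<close> is the level of the atom \<open>{i}\<close>.
\<close>

definition power_structure :: "'j set list \<Rightarrow> (nat set, 'j) ordered_lj_structure" where
  "power_structure Ls = \<lparr>univ = Pow {..<length Ls}, join = (\<union>), meet = (\<inter>), zero = {},
     one = {..<length Ls}, compl = (\<lambda>X. {..<length Ls} - X),
     pred = (\<lambda>j. {X. X \<subseteq> {..<length Ls} \<and> (\<forall>i\<in>X. j \<in> Ls ! i)}),
     ord_rel = {(X, Y). X \<subseteq> {..<length Ls} \<and> Y \<subseteq> {..<length Ls} \<and> first_difference_in X Y}\<rparr>"

lemma power_structure_simps [simp]:
  "univ (power_structure Ls) = Pow {..<length Ls}"
  "join (power_structure Ls) = (\<union>)"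
  "meet (power_structure Ls) = (\<inter>)"
  "zero (power_structure Ls) = {}"
  "one (power_structure Ls) = {..<length Ls}"
  "compl (power_structure Ls) X = {..<length Ls} - X"
  "X \<in> pred (power_structure Ls) j \<longleftrightarrow> X \<subseteq> {..<length Ls} \<and> (\<forall>i\<in>X. j \<in> Ls ! i)"
  "(X, Y) \<in> ord_rel (power_structure Ls) \<longleftrightarrow>
     X \<subseteq> {..<length Ls} \<and> Y \<subseteq> {..<length Ls} \<and> first_difference_in X Y"
  by (auto simp: power_structure_def)

lemma first_difference_total: "X \<noteq> Y \<Longrightarrow> first_difference_in X Y \<or> first_difference_in Y X"
proof -
  assume "X \<noteq> Y"
  let ?P = "\<lambda>i. i \<in> X \<longleftrightarrow> i \<notin> Y"
  obtain i0 where "?P i0" using \<open>X \<noteq> Y\<close> by blast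
  then have i: "?P (Least ?P)" by (rule LeastI)
  have "i' \<in> X \<longleftrightarrow> i' \<in> Y" if "i' < Least ?P" for i' using not_less_Least[OF that] by simp
  then show ?thesis using i unfolding first_difference_in_def by blast
qed

lemma first_difference_asym: "first_difference_in X Y \<Longrightarrow> \<not> first_difference_in Y X"
  unfolding first_difference_in_def by (metis DiffD1 DiffD2 linorder_neqE_nat)

lemma first_difference_bounded:
  assumes "X \<subseteq> {..<n}" "Y \<subseteq> {..<n}"
  shows "first_difference_in X Y \<longleftrightarrow> (\<exists>i<n. (i \<in> X \<longleftrightarrow> i \<notin> Y) \<and>
    (\<forall>i'<n. (i' \<in> X \<longleftrightarrow> i' \<notin> Y) \<and> i' \<noteq> i \<longrightarrow> i < i') \<and> i \<in> Y)"
proof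
  assume "first_difference_in X Y"
  then obtain i where i: "i \<in> Y" "i \<notin> X" "\<forall>i'<i. i' \<in> X \<longleftrightarrow> i' \<in> Y"
    unfolding first_difference_in_def by blast
  then have "i < i'" if "i' \<in> X \<longleftrightarrow> i' \<notin> Y" "i' \<noteq> i" for i'
    using that by (metis linorder_neqE_nat)
  then show "\<exists>i<n. (i \<in> X \<longleftrightarrow> i \<notin> Y) \<and>
    (\<forall>i'<n. (i' \<in> X \<longleftrightarrow> i' \<notin> Y) \<and> i' \<noteq> i \<longrightarrow> i < i') \<and> i \<in> Y"
    using i assms by blast
next
  assume "\<exists>i<n. (i \<in> X \<longleftrightarrow> i \<notin> Y) \<and>
    (\<forall>i'<n. (i' \<in> X \<longleftrightarrow> i' \<notin> Y) \<and> i' \<noteq> i \<longrightarrow> i < i') \<and> i \<in> Y"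
  then obtain i where i: "i < n" "i \<in> Y" "i \<notin> X"
    "\<And>i'. i' < n \<Longrightarrow> (i' \<in> X \<longleftrightarrow> i' \<notin> Y) \<Longrightarrow> i' \<noteq> i \<Longrightarrow> i < i'" by blast
  have "i' \<in> X \<longleftrightarrow> i' \<in> Y" if "i' < i" for i' using i(4)[of i'] i(1) that by auto
  then show "first_difference_in X Y" using i unfolding first_difference_in_def by blast
qed

text \<open>
  The levels of all atoms except the largest one, which has the empty level.
\<close>

definition level_list :: "'j set \<Rightarrow> 'j rel \<Rightarrow> 'j set list \<Rightarrow> bool" where
  "level_list J r Ls \<longleftrightarrow> sorted_wrt (\<le>) Ls \<and>
     (\<forall>L\<in>set Ls. L \<noteq> {} \<and> L \<subseteq> J \<and> (\<forall>i\<in>L. \<forall>j\<in>J. (i, j) \<in> r \<longrightarrow> j \<in> L))"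

text \<open>
  An atom of larger level is smaller in a proper ordering. Hence the levels increase along the
  enumeration from the largest atom down, beginning with the only empty level.
\<close>

lemma NA_Bu_representation:
  assumes r: "linear_order_on J r" and A: "A \<in> NA_Bu J r"
  shows "\<exists>Ls \<phi>. level_list J r Ls \<and> embedding J A (power_structure ({} # Ls)) \<phi> \<and>
    \<phi> ` univ A = univ (power_structure ({} # Ls))"
proof -
  have B: "A \<in> Bu J r" using A by (simp add: NA_Bu_def)
  then have fin: "finite (univ A)" and bas: "boolean_algebra_structure A"
    and ideal: "\<And>j. j \<in> J \<Longrightarrow> nontrivial_ideal A (pred A j)"
    and mono': "\<And>i j. \<lbrakk>i \<in> J; j \<in> J; (i, j) \<in> r; i \<noteq> j\<rbrakk> \<Longrightarrow> pred A i \<subseteq> pred A j"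
    and unique: "\<exists>!a. a \<in> atoms A \<and> (\<forall>j\<in>J. a \<notin> pred A j)"
    unfolding Bu_def by blast+
  interpret boolean_algebra_structure A by (rule bas)
  have mono: "pred A i \<subseteq> pred A j" if "i \<in> J" "j \<in> J" "(i, j) \<in> r" for i j
    using mono'[OF that] by (cases "i = j") auto
  obtain s where s: "proper_ordering J r A s" and ord: "ord_rel A = antilex_extension A s"
    using A by (auto simp: NA_Bu_def natural_ordering_def)
  have lin: "strict_linear_order_on (atoms A) s" using s by (simp add: proper_ordering_def)
  then have asym: "(y, x) \<notin> s" if "(x, y) \<in> s" for x y
    using that unfolding strict_linear_order_on_def irrefl_def by (metis transD)
  have fin_atoms: "finite (atoms A)" using fin by (simp add: atoms_def)
  obtain xs where xs: "set xs = atoms A" and sorted: "sorted_wrt (\<lambda>x y. (y, x) \<in> s) xs"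
    using strict_linear_order_enumeration[OF fin_atoms lin] by blast
  have s_iff: "(xs ! q, xs ! p) \<in> s \<longleftrightarrow> p < q" if "p < length xs" "q < length xs" for p q
    using that sorted asym by (metis linorder_neqE_nat sorted_wrt_nth_less)
  have inj: "xs ! p = xs ! q \<longleftrightarrow> p = q" if "p < length xs" "q < length xs" for p q
    using that s_iff by (metis linorder_neqE_nat less_irrefl_nat)
  define level where "level a = {j \<in> J. a \<in> pred A j}" for a
  have proper: "(a, b) \<in> s"
    if "a \<in> atoms A" "b \<in> atoms A" "i \<in> level a" "i \<notin> level b" for a b i
  proof (cases "level b = {}")
    case True
    then show ?thesis using s that unfolding proper_ordering_def level_def by blast
  next
    case False
    then obtain j where j: "j \<in> J" "b \<in> pred A j" unfolding level_def by blast
    have i: "i \<in> J" "a \<in> pred A i" "b \<notin> pred A i" using that unfolding level_def by auto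
    have "i \<noteq> j" using i j by blast
    have "(j, i) \<notin> r" using mono[of j i] i j by blast
    then have "(i, j) \<in> r" using r i j \<open>i \<noteq> j\<close> unfolding linear_order_on_def total_on_def by blast
    then show ?thesis
      using s that(1,2) i j \<open>i \<noteq> j\<close> unfolding proper_ordering_def by blast
  qed
  obtain t where t: "t \<in> atoms A" "level t = {}" "\<And>a. a \<in> atoms A \<Longrightarrow> level a = {} \<Longrightarrow> a = t"
    using unique unfolding level_def by blast
  obtain y ys where y: "xs = y # ys" using t(1) xs by (cases xs) auto
  have "y = t"
  proof (rule ccontr)
    assume "y \<noteq> t"
    then have "(t, y) \<in> s" using t(1) xs sorted y by auto
    moreover have "level y \<noteq> {}" using t(3) \<open>y \<noteq> t\<close> xs y by auto
    then have "(y, t) \<in> s" using proper[of y t] t(1,2) xs y by auto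
    ultimately show False using asym by blast
  qed
  have "t \<notin> set ys" using sorted y \<open>y = t\<close> asym by auto
  have levels: "level_list J r (map level ys)"
    unfolding level_list_def
  proof (intro conjI ballI impI)
    have "sorted_wrt (\<lambda>a b. level a \<le> level b) ys"
    proof (rule sorted_wrt_mono_rel)
      show "sorted_wrt (\<lambda>a b. (b, a) \<in> s) ys" using sorted y by simp
      show "level a \<subseteq> level b" if "a \<in> set ys" "b \<in> set ys" "(b, a) \<in> s" for a b
        using that proper[of a b] asym xs y by auto
    qed
    then show "sorted_wrt (\<le>) (map level ys)" by (simp add: sorted_wrt_map)
  next
    fix L assume "L \<in> set (map level ys)"
    then obtain a where a: "a \<in> set ys" "L = level a" by auto
    then show "L \<noteq> {}" using t(3) \<open>t \<notin> set ys\<close> xs y by auto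
    show "L \<subseteq> J" using a by (auto simp: level_def)
    show "j \<in> L" if "i \<in> L" "j \<in> J" "(i, j) \<in> r" for i j
      using that a mono by (auto simp: level_def)
  qed
  define Ls where "Ls = {} # map level ys"
  have Ls: "Ls = map level xs" using y \<open>y = t\<close> t(2) by (simp add: Ls_def)
  then have [simp]: "length Ls = length xs" by simp
  define \<phi> where "\<phi> x = {i. i < length xs \<and> below A (xs ! i) x}" for x
  have atom: "xs ! i \<in> atoms A" if "i < length xs" for i using nth_mem[OF that] unfolding xs .
  have \<phi>_mem: "i \<in> \<phi> x \<longleftrightarrow> i < length xs \<and> below A (xs ! i) x" for i x by (simp add: \<phi>_def)
  have inj_\<phi>: "inj_on \<phi> (univ A)"
  proof (rule inj_onI)
    fix x z assume "x \<in> univ A" "z \<in> univ A" "\<phi> x = \<phi> z"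
    moreover from this have "below A a x \<longleftrightarrow> below A a z" if "a \<in> atoms A" for a
      using that \<phi>_mem unfolding xs[symmetric] by (metis in_set_conv_nth)
    ultimately show "x = z" by (intro eq_if_same_atoms[OF fin])
  qed
  have onto: "\<phi> ` univ A = Pow {..<length xs}"
  proof (intro equalityI subsetI)
    fix X assume "X \<in> Pow {..<length xs}"
    then have X: "X \<subseteq> {..<length xs}" by simp
    then have "finite ((!) xs ` X)" "(!) xs ` X \<subseteq> atoms A" using atom by (auto intro: finite_subset)
    from ex_join_of_atoms[OF this] obtain x where x: "x \<in> univ A"
      "\<forall>a\<in>atoms A. below A a x \<longleftrightarrow> a \<in> (!) xs ` X" by blast
    then have "i \<in> \<phi> x \<longleftrightarrow> i \<in> X" for i
      using X atom[of i] inj by (force simp: \<phi>_mem)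
    then have "\<phi> x = X" by blast
    then show "X \<in> \<phi> ` univ A" using x(1) by blast
  qed (auto simp: \<phi>_def)
  have \<phi>_pred: "x \<in> pred A j \<longleftrightarrow> \<phi> x \<in> pred (power_structure Ls) j" if "j \<in> J" "x \<in> univ A" for x j
  proof -
    have "x \<in> pred A j \<longleftrightarrow> (\<forall>a\<in>set xs. below A a x \<longrightarrow> a \<in> pred A j)"
      using ideal_determined_by_atoms[OF fin ideal that(2)] that xs by simp
    then show ?thesis using that(1)
      by (auto simp: all_set_conv_all_nth Ls level_def \<phi>_mem)
  qed
  have \<phi>_ord: "(x, z) \<in> ord_rel A \<longleftrightarrow> (\<phi> x, \<phi> z) \<in> ord_rel (power_structure Ls)"
    if "x \<in> univ A" "z \<in> univ A" for x z
  proof -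
    have sep: "xs ! i \<in> separating_atoms A x z \<longleftrightarrow> (i \<in> \<phi> x \<longleftrightarrow> i \<notin> \<phi> z)" if "i < length xs" for i
      using that atom by (auto simp: separating_atoms_def \<phi>_mem)
    have "(x, z) \<in> antilex_extension A s \<longleftrightarrow> x \<noteq> z \<and> (\<exists>a\<in>set xs. a \<in> separating_atoms A x z \<and>
        (\<forall>b\<in>set xs. b \<in> separating_atoms A x z \<and> b \<noteq> a \<longrightarrow> (b, a) \<in> s) \<and> below A a z)"
      using that unfolding antilex_extension_def xs separating_atoms_def by auto
    also have "\<dots> \<longleftrightarrow> x \<noteq> z \<and> (\<exists>i<length xs. xs ! i \<in> separating_atoms A x z \<and>
        (\<forall>i'<length xs. xs ! i' \<in> separating_atoms A x z \<and> xs ! i' \<noteq> xs ! i \<longrightarrow> (xs ! i', xs ! i) \<in> s) \<and>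
        below A (xs ! i) z)"
      unfolding set_conv_nth by blast
    also have "\<dots> \<longleftrightarrow> x \<noteq> z \<and> (\<exists>i<length xs. (i \<in> \<phi> x \<longleftrightarrow> i \<notin> \<phi> z) \<and>
        (\<forall>i'<length xs. (i' \<in> \<phi> x \<longleftrightarrow> i' \<notin> \<phi> z) \<and> i' \<noteq> i \<longrightarrow> i < i') \<and> i \<in> \<phi> z)"
      using sep s_iff inj \<phi>_mem by meson
    also have "\<dots> \<longleftrightarrow> first_difference_in (\<phi> x) (\<phi> z)"
      by (subst first_difference_bounded[of _ "length xs"]) (auto simp: \<phi>_mem)
    finally show ?thesis unfolding ord by (auto simp: \<phi>_mem)
  qed
  have "embedding J A (power_structure Ls) \<phi>"
    unfolding embedding_def
    using inj_\<phi> onto \<phi>_pred \<phi>_ord atom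
    by (auto simp: \<phi>_mem atom_below_join atom_below_meet atom_below_zero atom_below_one atom_below_compl)
  moreover have "\<phi> ` univ A = univ (power_structure Ls)" using onto by simp
  ultimately show ?thesis using levels unfolding Ls_def by blast
qed

section \<open>Embeddings and copies\<close>

lemma embedding_compose:
  assumes "embedding J A B f" "embedding J B C g"
  shows "embedding J A C (g \<circ> f)"
proof -
  have "f x \<in> univ B" if "x \<in> univ A" for x using that assms(1) by (auto simp: embedding_def)
  then show ?thesis
    using assms unfolding embedding_def by (auto simp: image_subset_iff intro!: comp_inj_on elim: inj_on_subset)
qed

lemma subuniverse_image:
  assumes "subuniverse A (univ A)" "embedding J A B f"
  shows "subuniverse B (f ` univ A)"
  using assms unfolding embedding_def subuniverse_def
  by (auto simp: image_iff) (metis)+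

lemma embedding_inv_into:
  assumes A: "subuniverse A (univ A)" and f: "embedding J A B f" and onto: "f ` univ A = univ B"
  shows "embedding J B A (inv_into (univ A) f)"
proof -
  have inj: "inj_on f (univ A)" using f by (simp add: embedding_def)
  have [simp]: "inv_into (univ A) f (f x) = x" if "x \<in> univ A" for x using inj that by simp
  have closed: "zero A \<in> univ A" "one A \<in> univ A" "\<And>x. x \<in> univ A \<Longrightarrow> compl A x \<in> univ A"
    "\<And>x y. x \<in> univ A \<Longrightarrow> y \<in> univ A \<Longrightarrow> join A x y \<in> univ A"
    "\<And>x y. x \<in> univ A \<Longrightarrow> y \<in> univ A \<Longrightarrow> meet A x y \<in> univ A"
    using A by (auto simp: subuniverse_def)
  have hom: "join B (f x) (f y) = f (join A x y)" "meet B (f x) (f y) = f (meet A x y)"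
    "compl B (f x) = f (compl A x)"
    "(f x, f y) \<in> ord_rel B \<longleftrightarrow> (x, y) \<in> ord_rel A"
    if "x \<in> univ A" "y \<in> univ A" for x y
    using f that by (auto simp: embedding_def)
  have hom0: "zero B = f (zero A)" "one B = f (one A)" using f by (auto simp: embedding_def)
  have pred: "f x \<in> pred B j \<longleftrightarrow> x \<in> pred A j" if "x \<in> univ A" "j \<in> J" for x j
    using f that by (auto simp: embedding_def)
  show ?thesis
    unfolding embedding_def onto[symmetric]
    using inj_on_inv_into[of "f ` univ A" f "univ A"] closed
    by (simp add: hom pred hom0 ball_simps image_subset_iff)
qed

lemma induced_induced: "T \<subseteq> S \<Longrightarrow> induced (induced C S) T = induced C T"
  by (simp add: induced_def Int_assoc Int_absorb1 Times_Int_Times)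

text \<open>
  Reduces colourings of copies to colourings of embeddings.
\<close>

lemma copies_eq:
  assumes "subuniverse A (univ A)"
  shows "copies J A C = {induced C (f ` univ A) | f. embedding J A C f}"
proof (intro equalityI subsetI)
  fix D assume "D \<in> copies J A C"
  then obtain S f where S: "D = induced C S" "subuniverse C S"
    and f: "embedding J A (induced C S) f" "f ` univ A = S"
    unfolding copies_def isomorphic_def by (auto simp: induced_def)
  then have "embedding J A C f"
    unfolding embedding_def induced_def subuniverse_def by (auto simp: image_subset_iff)
  then show "D \<in> {induced C (f ` univ A) | f. embedding J A C f}" using S f by blast
next
  fix D assume "D \<in> {induced C (f ` univ A) | f. embedding J A C f}"
  then obtain f where f: "D = induced C (f ` univ A)" "embedding J A C f" by blast
  then have "embedding J A (induced C (f ` univ A)) f"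
    unfolding embedding_def induced_def by auto
  moreover have "univ (induced C (f ` univ A)) = f ` univ A" by (simp add: induced_def)
  ultimately show "D \<in> copies J A C"
    using subuniverse_image[OF assms f(2)] f(1) unfolding copies_def isomorphic_def by blast
qed

lemma embedding_onto_copy:
  assumes "embedding J B C f"
  shows "embedding J B (induced C (f ` univ B)) f"
  using assms unfolding embedding_def induced_def by auto

section \<open>Embeddings as parameter words\<close>

text \<open>
  The form in which embeddings produce and use parameter words.
\<close>

lemma pword_iff_first_occurrences:
  "pword a as bs v \<longleftrightarrow> length v = length bs \<and> set v \<subseteq> {..<a + length as} \<and>
    (\<forall>i<length as. \<exists>p<length bs. v ! p = a + i \<and> bs ! p = as ! i \<and> (\<forall>q<p. v ! q < a + i))"
  (is "_ \<longleftrightarrow> ?R a as bs v")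
proof
  assume "pword a as bs v"
  then show "?R a as bs v"
  proof (induction a as bs v rule: pword.induct)
    case (2 a as c cs x w)
    show ?case
    proof (cases "x < a")
      case True
      then have "?R a as cs w" using 2 by auto
      moreover have "\<exists>p<length (c # cs). (x # w) ! p = a + i \<and> (c # cs) ! p = as ! i \<and> (\<forall>q<p. (x # w) ! q < a + i)"
        if "i < length as" for i
      proof -
        obtain p where "p < length cs" "w ! p = a + i" "cs ! p = as ! i" "\<forall>q<p. w ! q < a + i"
          using calculation \<open>i < length as\<close> by auto
        then show ?thesis using True
          by (intro exI[of _ "Suc p"]) (auto simp: less_Suc_eq_0_disj)
      qed
      ultimately show ?thesis using True by auto
    next
      case False
      then obtain as' where as: "x = a" "as = c # as'" "pword (Suc a) as' cs w" using 2 by auto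
      then have R: "?R (Suc a) as' cs w" using 2 by auto
      have "\<exists>p<length (c # cs). (x # w) ! p = a + i \<and> (c # cs) ! p = as ! i \<and> (\<forall>q<p. (x # w) ! q < a + i)"
        if i: "i < length as" for i
      proof (cases i)
        case 0
        then show ?thesis using as by (intro exI[of _ 0]) auto
      next
        case (Suc i')
        then have "i' < length as'" using i as by simp
        then obtain p where p: "p < length cs" "w ! p = Suc a + i'" "cs ! p = as' ! i'"
          and before: "\<And>q. q < p \<Longrightarrow> w ! q < Suc a + i'"
          using R by blast
        have "(x # w) ! q < a + i" if "q < Suc p" for q
          using that before as(1) Suc by (cases q) auto
        then show ?thesis using p Suc as(1,2) by (intro exI[of _ "Suc p"]) simp
      qed
      then show ?thesis using R as by auto
    qed
  qed auto
next
  assume "?R a as bs v"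
  then show "pword a as bs v"
  proof (induction v arbitrary: a as bs)
    case Nil
    then show ?case by auto
  next
    case (Cons x v)
    then obtain b bs' where bs: "bs = b # bs'" by (cases bs) auto
    show ?case
    proof (cases "x < a")
      case True
      have "?R a as bs' v"
      proof (intro conjI allI impI)
        fix i assume "i < length as"
        then obtain p where p: "p < length bs" "(x # v) ! p = a + i" "bs ! p = as ! i"
          and before: "\<And>q. q < p \<Longrightarrow> (x # v) ! q < a + i"
          using Cons.prems by blast
        obtain p' where p': "p = Suc p'" using p(2) True by (cases p) auto
        have "v ! q < a + i" if "q < p'" for q using before[of "Suc q"] that p' by simp
        then show "\<exists>p<length bs'. v ! p = a + i \<and> bs' ! p = as ! i \<and> (\<forall>q<p. v ! q < a + i)"
          using p bs p' by (intro exI[of _ p']) simp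
      qed (use Cons.prems bs in auto)
      then show ?thesis using Cons.IH True bs by simp
    next
      case False
      then obtain l as' where as: "as = l # as'" using Cons.prems by (cases as) auto
      obtain p where p: "(x # v) ! p = a" "bs ! p = l" "\<forall>q<p. (x # v) ! q < a"
        using Cons.prems as by fastforce
      have "p = 0" using p(3) False by (cases p) auto
      then have x: "x = a" "b = l" using p bs by auto
      have "?R (Suc a) as' bs' v"
      proof (intro conjI allI impI)
        fix i assume "i < length as'"
        then obtain p where p: "p < length bs" "(x # v) ! p = a + Suc i" "bs ! p = as ! Suc i"
          and before: "\<And>q. q < p \<Longrightarrow> (x # v) ! q < a + Suc i"
          using Cons.prems as by (metis Suc_less_eq length_Cons)
        obtain p' where p': "p = Suc p'" using p(2) x by (cases p) auto
        have "v ! q < Suc a + i" if "q < p'" for q using before[of "Suc q"] that p' by simp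
        then show "\<exists>p<length bs'. v ! p = Suc a + i \<and> bs' ! p = as' ! i \<and> (\<forall>q<p. v ! q < Suc a + i)"
          using p bs as p' by (intro exI[of _ p']) simp
      qed (use Cons.prems bs as in auto)
      then show ?thesis using Cons.IH x bs as by simp
    qed
  qed
qed

text \<open>
  The embedding dual to the map \<open>p \<mapsto> w ! p\<close> on atoms.
\<close>

definition word_preimage :: "nat list \<Rightarrow> nat set \<Rightarrow> nat set" where
  "word_preimage w X = {p. p < length w \<and> w ! p \<in> X}"

lemma word_preimage_plug:
  "set u \<subseteq> {..<length v} \<Longrightarrow> word_preimage u (word_preimage v X) = word_preimage (plug v u) X"
  by (auto simp: word_preimage_def) (metis lessThan_iff nth_mem subsetD)

lemma level_list_mono:
  assumes "level_list J r Ls" "p \<le> q" "q < length ({} # Ls)"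
  shows "({} # Ls) ! p \<subseteq> ({} # Ls) ! q"
proof -
  have "sorted_wrt (\<le>) ({} # Ls)" using assms(1) by (simp add: level_list_def)
  then show ?thesis
    using assms(2,3) sorted_wrt_nth_less[of "(\<le>)" "{} # Ls" p q] by (cases "p = q") auto
qed

lemma level_list_subset: "level_list J r Ls \<Longrightarrow> p < length ({} # Ls) \<Longrightarrow> ({} # Ls) ! p \<subseteq> J"
  unfolding level_list_def by (cases p) auto

text \<open>
  Ideals are preserved because the first occurrence of a letter has the level of the letter and, the
  levels being sorted, the smallest level among all occurrences. The order is preserved because the
  sets \<open>X\<close> and \<open>Y\<close> differ first at a letter \<open>i\<close> iff their preimages differ first at the first
  occurrence of \<open>i\<close>.
\<close>

lemma word_embedding:
  assumes bs: "level_list J r bs" and w: "pword 0 ({} # as) ({} # bs) w"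
  shows "embedding J (power_structure ({} # as)) (power_structure ({} # bs)) (word_preimage w)"
proof -
  let ?as = "{} # as" and ?bs = "{} # bs"
  have len: "length w = length ?bs" and letters: "set w \<subseteq> {..<length ?as}"
    and occurs: "\<And>i. i < length ?as \<Longrightarrow>
      \<exists>p<length ?bs. w ! p = i \<and> ?bs ! p = ?as ! i \<and> (\<forall>q<p. w ! q < i)"
    using w unfolding pword_iff_first_occurrences by auto
  have letter: "w ! p < length ?as" if "p < length ?bs" for p
    using letters len that by (metis lessThan_iff nth_mem subsetD)
  have mem: "p \<in> word_preimage w X \<longleftrightarrow> p < length ?bs \<and> w ! p \<in> X" for p X
    by (simp add: word_preimage_def len)
  have inj: "inj_on (word_preimage w) (Pow {..<length ?as})"
  proof (rule inj_onI)
    fix X Y assume "X \<in> Pow {..<length ?as}" "Y \<in> Pow {..<length ?as}" "word_preimage w X = word_preimage w Y"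
    then show "X = Y" using occurs mem by (metis Pow_iff lessThan_iff set_eqI subsetD)
  qed
  have level: "(\<forall>i\<in>X. j \<in> ?as ! i) \<longleftrightarrow> (\<forall>p\<in>word_preimage w X. j \<in> ?bs ! p)"
    if X: "X \<subseteq> {..<length ?as}" for X j
  proof
    assume *: "\<forall>i\<in>X. j \<in> ?as ! i"
    show "\<forall>p\<in>word_preimage w X. j \<in> ?bs ! p"
    proof
      fix p assume "p \<in> word_preimage w X"
      then have p: "p < length ?bs" "w ! p \<in> X" by (simp_all add: mem)
      obtain p' where p': "p' < length ?bs" "w ! p' = w ! p" "?bs ! p' = ?as ! (w ! p)" "\<forall>q<p'. w ! q < w ! p"
        using occurs[OF letter[OF p(1)]] by blast
      then have "p' \<le> p" by (metis less_irrefl not_le)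
      then have "?bs ! p' \<subseteq> ?bs ! p" using level_list_mono[OF bs] p(1) by blast
      then show "j \<in> ?bs ! p" using p' p * by auto
    qed
  next
    assume *: "\<forall>p\<in>word_preimage w X. j \<in> ?bs ! p"
    show "\<forall>i\<in>X. j \<in> ?as ! i"
    proof
      fix i assume "i \<in> X"
      then obtain p where "p < length ?bs" "w ! p = i" "?bs ! p = ?as ! i" using occurs X by blast
      then show "j \<in> ?as ! i" using * mem \<open>i \<in> X\<close> by metis
    qed
  qed
  have diff: "first_difference_in (word_preimage w X) (word_preimage w Y)"
    if XY: "first_difference_in X Y" "Y \<subseteq> {..<length ?as}" for X Y
  proof -
    obtain i where i: "i \<in> Y" "i \<notin> X" "\<forall>i'<i. i' \<in> X \<longleftrightarrow> i' \<in> Y"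
      using XY(1) unfolding first_difference_in_def by blast
    then obtain p where "p < length ?bs" "w ! p = i" "\<forall>q<p. w ! q < i" using occurs XY(2) by blast
    then show ?thesis using i unfolding first_difference_in_def mem by (intro bexI[of _ p]) (auto simp: mem)
  qed
  have diff_iff: "first_difference_in X Y \<longleftrightarrow> first_difference_in (word_preimage w X) (word_preimage w Y)"
    if "X \<subseteq> {..<length ?as}" "Y \<subseteq> {..<length ?as}" for X Y
    using that diff first_difference_total[of X Y] first_difference_asym by metis
  have sub: "word_preimage w X \<subseteq> {..<length ?bs}" for X by (auto simp: mem)
  show ?thesis
    unfolding embedding_def power_structure_simps
    using inj level diff_iff sub letter by (auto simp: mem simp del: length_Cons)
qed

text \<open>
  The images of the atoms partition the atoms of the target; the letter at \<open>p\<close> is the block that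
  contains \<open>p\<close>. For \<open>i < i'\<close>, comparing \<open>{i'}\<close> with \<open>{i}\<close> shows that the block of \<open>i\<close> begins before
  that of \<open>i'\<close>, and the level of a block is that of its first element.
\<close>

lemma embedding_is_word:
  assumes as: "level_list J r as" and bs: "level_list J r bs"
    and g: "embedding J (power_structure ({} # as)) (power_structure ({} # bs)) g"
  shows "\<exists>v. pword 0 ({} # as) ({} # bs) v \<and> (\<forall>X\<subseteq>{..<length ({} # as)}. g X = word_preimage v X)"
proof -
  let ?as = "{} # as" and ?bs = "{} # bs"
  let ?n = "length ?as" and ?m = "length ?bs"
  have sub: "g X \<subseteq> {..<?m}" if "X \<subseteq> {..<?n}" for X
    using g that unfolding embedding_def by (auto simp: image_subset_iff)
  have union: "g (X \<union> Y) = g X \<union> g Y" and inter: "g (X \<inter> Y) = g X \<inter> g Y"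
    if "X \<subseteq> {..<?n}" "Y \<subseteq> {..<?n}" for X Y
    using g that unfolding embedding_def by auto
  have empty: "g {} = {}" and full: "g {..<?n} = {..<?m}"
    using g unfolding embedding_def by (auto simp del: length_Cons)
  have level: "(\<forall>i\<in>X. j \<in> ?as ! i) \<longleftrightarrow> (\<forall>p\<in>g X. j \<in> ?bs ! p)" if "X \<subseteq> {..<?n}" "j \<in> J" for X j
    using g that sub[of X] unfolding embedding_def by auto
  have ord: "first_difference_in X Y \<Longrightarrow> first_difference_in (g X) (g Y)"
    if "X \<subseteq> {..<?n}" "Y \<subseteq> {..<?n}" for X Y
    using g that unfolding embedding_def by auto
  have inj: "inj_on g (Pow {..<?n})" using g unfolding embedding_def by simp
  have nonempty: "g {i} \<noteq> {}" if "i < ?n" for i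
  proof
    assume "g {i} = {}"
    then have "g {i} = g {}" using empty by (simp only:)
    then have "{i} = {}" by (rule inj_onD[OF inj]) (use that in \<open>simp_all del: length_Cons\<close>)
    then show False by simp
  qed
  have covered: "\<exists>i\<in>X. p \<in> g {i}" if "finite X" "X \<subseteq> {..<?n}" "p \<in> g X" for X p
    using that
  proof (induction X)
    case empty
    then show ?case using \<open>g {} = {}\<close> by simp
  next
    case (insert i X)
    then have "g (insert i X) = g {i} \<union> g X" using union[of "{i}" X] by simp
    then show ?case using insert by auto
  qed
  define v where "v = map (\<lambda>p. SOME i. i < ?n \<and> p \<in> g {i}) [0..<?m]"
  have len: "length v = ?m" by (simp add: v_def)
  have v: "v ! p < ?n \<and> p \<in> g {v ! p}" if "p < ?m" for p
  proof -
    have "\<exists>i. i < ?n \<and> p \<in> g {i}" using covered[of "{..<?n}" p] full that by auto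
    from someI_ex[OF this] show ?thesis using that by (simp add: v_def del: upt_Suc length_Cons)
  qed
  have mem: "p \<in> g X \<longleftrightarrow> p < ?m \<and> v ! p \<in> X" if "X \<subseteq> {..<?n}" for p X
  proof (cases "p < ?m")
    case True
    have "g ({v ! p} \<inter> X) = g {v ! p} \<inter> g X" using v[OF True] that by (intro inter) auto
    then show ?thesis using v[OF True] True empty by (cases "v ! p \<in> X") auto
  next
    case False
    then show ?thesis using sub[OF that] by auto
  qed
  have "pword 0 ?as ?bs v"
    unfolding pword_iff_first_occurrences
  proof (intro conjI allI impI)
    show "length v = ?m" by (rule len)
    show "set v \<subseteq> {..<0 + ?n}" using v by (auto simp: in_set_conv_nth len simp del: length_Cons)
    fix i assume i: "i < ?n"
    define p where "p = Min (g {i})"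
    have fin: "finite (g {i})" using sub[of "{i}"] i finite_subset by auto
    have p: "p \<in> g {i}" unfolding p_def using fin nonempty[OF i] by (rule Min_in)
    have p_le: "p \<le> q" if "q \<in> g {i}" for q unfolding p_def using fin that by (rule Min_le)
    have "p < ?m" "v ! p = i" using p mem[of "{i}"] i by auto
    have "?bs ! p = ?as ! i"
    proof (intro equalityI subsetI)
      fix j assume j: "j \<in> ?bs ! p"
      then have "j \<in> J" using level_list_subset[OF bs \<open>p < ?m\<close>] by blast
      moreover have "\<forall>q\<in>g {i}. j \<in> ?bs ! q"
        using level_list_mono[OF bs p_le] sub[of "{i}"] i j by blast
      ultimately show "j \<in> ?as ! i" using level[of "{i}" j] i by simp
    next
      fix j assume j: "j \<in> ?as ! i"
      then have "j \<in> J" using level_list_subset[OF as i] by blast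
      then show "j \<in> ?bs ! p" using level[of "{i}" j] i j p by simp
    qed
    moreover have "v ! q < i" if "q < p" for q
    proof (rule ccontr)
      assume "\<not> v ! q < i"
      have q: "q < ?m" using that \<open>p < ?m\<close> by simp
      have "q \<notin> g {i}" using p_le that by (metis not_le)
      then have "v ! q \<noteq> i" using v[OF q] by auto
      then have "i < v ! q" using \<open>\<not> v ! q < i\<close> by simp
      then have "first_difference_in {v ! q} {i}" unfolding first_difference_in_def by auto
      then have "first_difference_in (g {v ! q}) (g {i})" using ord v[OF q] i by auto
      then obtain p' where p': "p' \<in> g {i}" "\<forall>q'<p'. q' \<in> g {v ! q} \<longleftrightarrow> q' \<in> g {i}"
        unfolding first_difference_in_def by blast
      have "q < p'" using p_le[OF p'(1)] that by simp
      then show False using p'(2) v[OF q] \<open>q \<notin> g {i}\<close> by blast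
    qed
    ultimately show "\<exists>p<?m. v ! p = 0 + i \<and> ?bs ! p = ?as ! i \<and> (\<forall>q<p. v ! q < 0 + i)"
      using \<open>p < ?m\<close> \<open>v ! p = i\<close> by auto
  qed
  moreover have "g X = word_preimage v X" if "X \<subseteq> {..<?n}" for X
    using mem[OF that] by (auto simp: word_preimage_def len simp del: length_Cons)
  ultimately show ?thesis by blast
qed

section \<open>Realising lists of levels\<close>

definition push_forward ::
  "(nat set \<Rightarrow> 'a) \<Rightarrow> (nat set, 'j) ordered_lj_structure \<Rightarrow> ('a, 'j) ordered_lj_structure" where
  "push_forward h P = (let g = inv_into (univ P) h in
    \<lparr>univ = h ` univ P, join = (\<lambda>x y. h (join P (g x) (g y))), meet = (\<lambda>x y. h (meet P (g x) (g y))),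
     zero = h (zero P), one = h (one P), compl = (\<lambda>x. h (compl P (g x))),
     pred = (\<lambda>j. h ` pred P j), ord_rel = map_prod h h ` ord_rel P\<rparr>)"

text \<open>
  Every list of levels is realised inside a prescribed type as soon as an injection \<open>h\<close> of the power
  set is given. The converse of \<open>NA_Bu_representation\<close>: sortedness of the levels makes the
  descending order of indices a proper ordering.
\<close>

lemma push_forward_power_structure:
  fixes h :: "nat set \<Rightarrow> 'a"
  assumes r: "linear_order_on J r" and Ls: "level_list J r Ls"
    and inj: "inj_on h (Pow {..<length ({} # Ls)})"
  defines "P \<equiv> power_structure ({} # Ls)"
  shows "embedding J P (push_forward h P) h" and "push_forward h P \<in> NA_Bu J r"
proof -
  let ?L = "{} # Ls"
  define n where "n = length ?L"
  let ?C = "push_forward h P"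
  have P: "univ P = Pow {..<n}" by (simp add: P_def n_def)
  have g: "inv_into (Pow {..<n}) h (h X) = X" if "X \<subseteq> {..<n}" for X
    using inj that by (simp add: n_def)
  have h_eq: "h X = h Y \<longleftrightarrow> X = Y" if "X \<subseteq> {..<n}" "Y \<subseteq> {..<n}" for X Y
    using inj that by (auto simp: n_def inj_on_def simp del: length_Cons)
  have univ_C: "univ ?C = h ` Pow {..<n}" by (simp add: push_forward_def P Let_def)
  have ops: "join ?C (h X) (h Y) = h (X \<union> Y)" "meet ?C (h X) (h Y) = h (X \<inter> Y)"
    "compl ?C (h X) = h ({..<n} - X)" if "X \<subseteq> {..<n}" "Y \<subseteq> {..<n}" for X Y
    using that g by (simp_all add: push_forward_def P Let_def) (simp_all add: P_def n_def)
  have constants: "zero ?C = h {}" "one ?C = h {..<n}"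
    by (simp_all add: push_forward_def Let_def P_def n_def)
  have pred_C: "h X \<in> pred ?C j \<longleftrightarrow> (\<forall>i\<in>X. j \<in> ?L ! i)" if "X \<subseteq> {..<n}" for X j
  proof -
    have "pred ?C j = h ` {X. X \<subseteq> {..<n} \<and> (\<forall>i\<in>X. j \<in> ?L ! i)}"
      unfolding push_forward_def Let_def P_def power_structure_def n_def by simp
    then show ?thesis using that h_eq by auto
  qed
  have pred_C_sub: "pred ?C j \<subseteq> h ` Pow {..<n}" for j
    unfolding push_forward_def Let_def P_def power_structure_def n_def by auto
  have ord_C: "ord_rel ?C = {(h X, h Y) | X Y. X \<subseteq> {..<n} \<and> Y \<subseteq> {..<n} \<and> first_difference_in X Y}"
    unfolding push_forward_def Let_def P_def power_structure_def n_def by auto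
  show "embedding J P ?C h"
    unfolding embedding_def univ_C P
    using inj ops constants pred_C ord_C h_eq
    by (auto simp: P_def n_def simp del: length_Cons)

  have fin: "finite (univ ?C)" by (simp add: univ_C)
  have bas: "boolean_algebra_structure ?C"
    by unfold_locales
      (auto simp: univ_C ops constants h_eq le_infI1 intro!: imageI arg_cong[of _ _ h])
  have below_C: "below ?C (h X) (h Y) \<longleftrightarrow> X \<subseteq> Y" if "X \<subseteq> {..<n}" "Y \<subseteq> {..<n}" for X Y
    using that h_eq[of "X \<inter> Y" X] by (auto simp: below_def ops)
  have atoms_C: "atoms ?C = (\<lambda>i. h {i}) ` {..<n}"
  proof (intro equalityI subsetI)
    fix a assume "a \<in> atoms ?C"
    then obtain X where X: "a = h X" "X \<subseteq> {..<n}" "X \<noteq> {}"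
      and min: "\<And>Y. \<lbrakk>Y \<subseteq> {..<n}; Y \<subseteq> X\<rbrakk> \<Longrightarrow> Y = {} \<or> Y = X"
      by (auto simp: atoms_def univ_C below_C constants h_eq)
    then obtain i where "i \<in> X" by blast
    then have "X = {i}" using min[of "{i}"] X by blast
    then show "a \<in> (\<lambda>i. h {i}) ` {..<n}" using X by auto
  qed (auto simp: atoms_def univ_C below_C constants h_eq subset_singleton_iff)
  have level0: "?L ! 0 = {}" by simp
  have level_pos: "?L ! i \<noteq> {}" "?L ! i \<subseteq> J" "\<And>k j. \<lbrakk>k \<in> ?L ! i; j \<in> J; (k, j) \<in> r\<rbrakk> \<Longrightarrow> j \<in> ?L ! i"
    if "0 < i" "i < n" for i
  proof -
    have "?L ! i \<in> set Ls" using that by (cases i) (auto simp: n_def)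
    then show "?L ! i \<noteq> {}" "?L ! i \<subseteq> J"
      "\<And>k j. \<lbrakk>k \<in> ?L ! i; j \<in> J; (k, j) \<in> r\<rbrakk> \<Longrightarrow> j \<in> ?L ! i"
      using Ls unfolding level_list_def by blast+
  qed
  have level: "?L ! i \<subseteq> ?L ! i'" if "i \<le> i'" "i' < n" for i i'
    using level_list_mono[OF Ls that(1)] that(2) by (simp add: n_def)
  have pred_atom: "h {i} \<in> pred ?C j \<longleftrightarrow> j \<in> ?L ! i" if "i < n" for i j
    using pred_C[of "{i}"] that by simp
  have "n > 0" by (simp add: n_def)
  have ideal: "nontrivial_ideal ?C (pred ?C j)" for j
    unfolding nontrivial_ideal_def
  proof (intro conjI ballI impI)
    show "pred ?C j \<subseteq> univ ?C" using pred_C_sub by (simp add: univ_C)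
    show "zero ?C \<in> pred ?C j" using pred_C[of "{}"] by (simp add: constants)
    show "one ?C \<notin> pred ?C j"
      using pred_C[of "{..<n}" j] level0 \<open>n > 0\<close> by (auto simp: constants dest!: bspec[of _ _ 0])
    show "x \<in> pred ?C j" if xy: "x \<in> univ ?C" "y \<in> pred ?C j" "below ?C x y" for x y
    proof -
      obtain X Y where "x = h X" "y = h Y" "X \<subseteq> {..<n}" "Y \<subseteq> {..<n}"
        using xy pred_C_sub univ_C by blast
      then show ?thesis using xy by (auto simp: below_C pred_C)
    qed
    show "join ?C x y \<in> pred ?C j" if xy: "x \<in> pred ?C j" "y \<in> pred ?C j" for x y
    proof -
      obtain X Y where "x = h X" "y = h Y" "X \<subseteq> {..<n}" "Y \<subseteq> {..<n}"
        using xy pred_C_sub by blast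
      then show ?thesis using xy by (auto simp: ops pred_C)
    qed
  qed
  have chain: "pred ?C i \<subseteq> pred ?C j" if "i \<in> J" "j \<in> J" "(i, j) \<in> r" for i j
  proof
    fix x assume "x \<in> pred ?C i"
    then obtain X where X: "x = h X" "X \<subseteq> {..<n}" "\<forall>k\<in>X. i \<in> ?L ! k"
      using pred_C_sub pred_C by blast
    have "j \<in> ?L ! k" if "k \<in> X" for k
    proof -
      have "i \<in> ?L ! k" "k < n" using that X by auto
      moreover from this have "0 < k" using level0 by (cases k) auto
      ultimately show ?thesis using level_pos(3) \<open>(i, j) \<in> r\<close> \<open>j \<in> J\<close> by blast
    qed
    then show "x \<in> pred ?C j" using X pred_C by blast
  qed
  have free: "(\<forall>j\<in>J. h {i} \<notin> pred ?C j) \<longleftrightarrow> i = 0" if "i < n" for i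
    using that level0 level_pos(1,2)[of i] by (cases "i = 0") (auto simp: pred_atom)
  have "\<exists>!a. a \<in> atoms ?C \<and> (\<forall>j\<in>J. a \<notin> pred ?C j)"
  proof (rule ex1I)
    show "h {0} \<in> atoms ?C \<and> (\<forall>j\<in>J. h {0} \<notin> pred ?C j)"
      using free[OF \<open>n > 0\<close>] \<open>n > 0\<close> by (auto simp: atoms_C)
    show "a = h {0}" if "a \<in> atoms ?C \<and> (\<forall>j\<in>J. a \<notin> pred ?C j)" for a
      using that free by (auto simp: atoms_C)
  qed
  then have Bu: "?C \<in> Bu J r"
    unfolding Bu_def using fin bas ideal chain by blast
  define s where "s = {(h {i}, h {i'}) | i i'. i' < i \<and> i < n}"
  have s_iff: "(h {i}, h {i'}) \<in> s \<longleftrightarrow> i' < i" if "i < n" "i' < n" for i i'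
  proof -
    have eq: "k = k'" if "h {k} = h {k'}" "k < n" "k' < n" for k k'
      using h_eq[of "{k}" "{k'}"] that by auto
    show ?thesis
    proof
      assume "(h {i}, h {i'}) \<in> s"
      then obtain k k' where k: "h {i} = h {k}" "h {i'} = h {k'}" "k' < k" "k < n"
        unfolding s_def by blast
      moreover have "k' < n" using k by simp
      ultimately show "i' < i" using eq[of i k] eq[of i' k'] that by simp
    qed (use that in \<open>auto simp: s_def\<close>)
  qed
  have s_sub: "s \<subseteq> atoms ?C \<times> atoms ?C" unfolding s_def atoms_C by auto
  have "proper_ordering J r ?C s"
    unfolding proper_ordering_def
  proof (intro conjI ballI impI s_sub)
    show "strict_linear_order_on (atoms ?C) s"
      unfolding strict_linear_order_on_def
    proof (intro conjI)
      show "trans s"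
      proof (rule transI)
        fix x y z assume *: "(x, y) \<in> s" "(y, z) \<in> s"
        then obtain i i' i'' where "x = h {i}" "y = h {i'}" "z = h {i''}" "i < n" "i' < n" "i'' < n"
          using s_sub unfolding atoms_C by blast
        then show "(x, z) \<in> s" using * by (auto simp: s_iff)
      qed
      show "irrefl s" unfolding irrefl_def
      proof
        fix x show "(x, x) \<notin> s" using s_sub s_iff unfolding atoms_C by blast
      qed
      show "total_on (atoms ?C) s" unfolding total_on_def atoms_C
        by (auto simp: s_iff) (metis linorder_neqE_nat)
    qed
    fix a b i assume "a \<in> atoms ?C" "b \<in> atoms ?C" "i \<in> J" and *: "a \<in> pred ?C i \<and>
        ((\<exists>j\<in>J. (i, j) \<in> r \<and> i \<noteq> j \<and> b \<in> pred ?C j - pred ?C i) \<or> (\<forall>k\<in>J. b \<notin> pred ?C k))"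
    then obtain p q where pq: "a = h {p}" "b = h {q}" "p < n" "q < n" by (auto simp: atoms_C)
    have "i \<in> ?L ! p" "i \<notin> ?L ! q" using * pq \<open>i \<in> J\<close> by (auto simp: pred_atom)
    then have "q < p" using level[of p q] pq by (metis not_le subsetD)
    then show "(a, b) \<in> s" using pq s_iff by simp
  qed
  moreover have "ord_rel ?C = antilex_extension ?C s"
  proof -
    have sep: "h {i} \<in> separating_atoms ?C (h X) (h Y) \<longleftrightarrow> (i \<in> X \<longleftrightarrow> i \<notin> Y)"
      if "i < n" "X \<subseteq> {..<n}" "Y \<subseteq> {..<n}" for i X Y
      using that by (auto simp: separating_atoms_def atoms_C below_C)
    have antilex: "(h X, h Y) \<in> antilex_extension ?C s \<longleftrightarrow> first_difference_in X Y"
      if XY: "X \<subseteq> {..<n}" "Y \<subseteq> {..<n}" for X Y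
    proof -
      have h1: "h {i} = h {i'} \<longleftrightarrow> i = i'" if "i < n" "i' < n" for i i' using h_eq[of "{i}" "{i'}"] that by auto
      have below1: "below ?C (h {i}) (h Y) \<longleftrightarrow> i \<in> Y" if "i < n" for i
        using below_C[of "{i}" Y] that XY(2) by simp
      have "(h X, h Y) \<in> antilex_extension ?C s \<longleftrightarrow> X \<noteq> Y \<and> (\<exists>a\<in>atoms ?C. a \<in> separating_atoms ?C (h X) (h Y) \<and>
        (\<forall>b\<in>atoms ?C. b \<in> separating_atoms ?C (h X) (h Y) \<and> b \<noteq> a \<longrightarrow> (b, a) \<in> s) \<and> below ?C a (h Y))"
        using XY h_eq unfolding antilex_extension_def separating_atoms_def by (auto simp: univ_C)
      also have "\<dots> \<longleftrightarrow> X \<noteq> Y \<and> (\<exists>i\<in>{..<n}. h {i} \<in> separating_atoms ?C (h X) (h Y) \<and>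
        (\<forall>i'\<in>{..<n}. h {i'} \<in> separating_atoms ?C (h X) (h Y) \<and> h {i'} \<noteq> h {i} \<longrightarrow> (h {i'}, h {i}) \<in> s) \<and>
        below ?C (h {i}) (h Y))"
        unfolding atoms_C by blast
      also have "\<dots> \<longleftrightarrow> X \<noteq> Y \<and> (\<exists>i\<in>{..<n}. (i \<in> X \<longleftrightarrow> i \<notin> Y) \<and>
        (\<forall>i'\<in>{..<n}. (i' \<in> X \<longleftrightarrow> i' \<notin> Y) \<and> i' \<noteq> i \<longrightarrow> i < i') \<and> i \<in> Y)"
      proof -
        have ordered: "(h {i'} \<in> separating_atoms ?C (h X) (h Y) \<and> h {i'} \<noteq> h {i} \<longrightarrow> (h {i'}, h {i}) \<in> s) \<longleftrightarrow>
            ((i' \<in> X \<longleftrightarrow> i' \<notin> Y) \<and> i' \<noteq> i \<longrightarrow> i < i')" if "i < n" "i' < n" for i i'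
          using sep[OF that(2) XY] s_iff[OF that(2,1)] h1[OF that(2,1)] by blast
        show ?thesis
        proof (intro conj_cong bex_cong ball_cong refl)
          fix i assume i: "i \<in> {..<n}"
          show "h {i} \<in> separating_atoms ?C (h X) (h Y) \<longleftrightarrow> (i \<in> X \<longleftrightarrow> i \<notin> Y)"
            using sep[OF _ XY] i by simp
          show "below ?C (h {i}) (h Y) \<longleftrightarrow> i \<in> Y" using below1 i by simp
          fix i' assume "i' \<in> {..<n}"
          then show "(h {i'} \<in> separating_atoms ?C (h X) (h Y) \<and> h {i'} \<noteq> h {i} \<longrightarrow> (h {i'}, h {i}) \<in> s) \<longleftrightarrow>
            ((i' \<in> X \<longleftrightarrow> i' \<notin> Y) \<and> i' \<noteq> i \<longrightarrow> i < i')"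
            using ordered i by simp
        qed
      qed
      also have "\<dots> \<longleftrightarrow> first_difference_in X Y"
        using first_difference_bounded[OF XY] by auto
      finally show ?thesis .
    qed
    have "(h X, h Y) \<in> ord_rel ?C \<longleftrightarrow> first_difference_in X Y"
      if "X \<subseteq> {..<n}" "Y \<subseteq> {..<n}" for X Y
      using that h_eq unfolding ord_C by auto
    with antilex have same: "(x, y) \<in> ord_rel ?C \<longleftrightarrow> (x, y) \<in> antilex_extension ?C s"
      if "x \<in> univ ?C" "y \<in> univ ?C" for x y
      using that unfolding univ_C by auto
    have "ord_rel ?C \<subseteq> univ ?C \<times> univ ?C" unfolding ord_C univ_C by auto
    moreover have "antilex_extension ?C s \<subseteq> univ ?C \<times> univ ?C" unfolding antilex_extension_def by auto
    ultimately show ?thesis using same by (intro equalityI subrelI) blast+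
  qed
  ultimately show "?C \<in> NA_Bu J r"
    using Bu unfolding NA_Bu_def natural_ordering_def by blast
qed

section \<open>The Ramsey property\<close>

text \<open>
  An embedding into a copy of \<open>B\<close> factors through \<open>B\<close>. This is why the copies of \<open>A\<close> in a copy of \<open>B\<close>
  are covered by the composites \<open>u \<circ> v\<close> of the Ramsey theorem for words.
\<close>

lemma embedding_into_copy_factors:
  assumes B: "subuniverse B (univ B)" and e: "embedding J B C e"
    and g: "embedding J A (induced C (e ` univ B)) g"
  shows "\<exists>k. embedding J A B k \<and> g ` univ A = e ` k ` univ A"
proof -
  let ?k = "inv_into (univ B) e"
  have "embedding J B (induced C (e ` univ B)) e" by (rule embedding_onto_copy[OF e])
  then have inv: "embedding J (induced C (e ` univ B)) B ?k"
    by (rule embedding_inv_into[OF B]) (simp add: induced_def)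
  have "g ` univ A \<subseteq> e ` univ B" using g by (auto simp: embedding_def induced_def)
  then have "e ` (?k \<circ> g) ` univ A = g ` univ A"
    by (auto simp: image_image f_inv_into_f image_subset_iff cong: image_cong_simp)
  then show ?thesis using embedding_compose[OF g inv] by metis
qed

lemma subuniverse_NA_Bu:
  assumes "A \<in> NA_Bu J r"
  shows "subuniverse A (univ A)"
proof -
  interpret boolean_algebra_structure A using assms by (simp add: NA_Bu_def Bu_def)
  show ?thesis
    unfolding subuniverse_def
    by (simp add: zero_closed one_closed compl_closed join_closed meet_closed)
qed

lemma ex_inj_on_finite:
  assumes "infinite (UNIV :: 'a set)" "finite S"
  shows "\<exists>h :: 'b \<Rightarrow> 'a. inj_on h S"
proof -
  obtain T :: "'a set" where "finite T" "card T = card S"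
    using infinite_arbitrarily_large[OF assms(1)] by blast
  then show ?thesis using bij_betw_iff_card[OF assms(2)] bij_betw_imp_inj_on by metis
qed

theorem theorem6:
  fixes J :: "'j set" and r :: "'j rel"
  assumes "linear_order_on J r"
    and "infinite (UNIV :: 'a set)"
  shows "ramsey_property J (NA_Bu J r :: ('a, 'j) ordered_lj_structure set)"
  unfolding ramsey_property_def
proof (intro ballI impI allI)
  fix A B :: "('a, 'j) ordered_lj_structure" and k :: nat
  assume A: "A \<in> NA_Bu J r" and B: "B \<in> NA_Bu J r" and k: "2 \<le> k"
  obtain as \<alpha> where as: "level_list J r as"
    and \<alpha>: "embedding J A (power_structure ({} # as)) \<alpha>" "\<alpha> ` univ A = univ (power_structure ({} # as))"
    using NA_Bu_representation[OF assms(1) A] by (elim exE conjE) (rule that)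
  obtain bs \<beta> where bs: "level_list J r bs"
    and \<beta>: "embedding J B (power_structure ({} # bs)) \<beta>" "\<beta> ` univ B = univ (power_structure ({} # bs))"
    using NA_Bu_representation[OF assms(1) B] by (elim exE conjE) (rule that)
  have "sorted_wrt (\<le>) bs" using bs by (simp add: level_list_def)
  then obtain cs where cs: "sorted_over bs cs" and ramsey: "ramsey_words 1 as bs k cs"
    using parameter_word_ramsey[of 1 bs as k] by auto
  have cs_levels: "level_list J r cs" using cs bs unfolding sorted_over_def level_list_def by blast
  obtain h :: "nat set \<Rightarrow> 'a" where h: "inj_on h (Pow {..<length ({} # cs)})"
    using ex_inj_on_finite[OF assms(2), of "Pow {..<length ({} # cs)}"] by blast
  define C where "C = push_forward h (power_structure ({} # cs))"
  have C: "C \<in> NA_Bu J r" and h_emb: "embedding J (power_structure ({} # cs)) C h"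
    unfolding C_def using push_forward_power_structure[OF assms(1) cs_levels h] by simp_all
  have word_copy: "embedding J D C (h \<circ> word_preimage (0 # u) \<circ> \<delta>)"
    if "embedding J D (power_structure ({} # ds)) \<delta>" "pword 1 ds cs u" for D :: "('a, 'j) ordered_lj_structure" and \<delta> ds u
  proof -
    have "pword 0 ({} # ds) ({} # cs) (0 # u)" using that(2) by simp
    from word_embedding[OF cs_levels this] show ?thesis
      using embedding_compose[OF embedding_compose[OF that(1)] h_emb] by (simp add: comp_assoc)
  qed
  show "\<exists>C\<in>NA_Bu J r. \<forall>\<chi> :: ('a, 'j) ordered_lj_structure \<Rightarrow> nat. \<chi> ` copies J A C \<subseteq> {..<k} \<longrightarrow>
      (\<exists>B'\<in>copies J B C. \<exists>c. \<forall>A'\<in>copies J A B'. \<chi> A' = c)"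
  proof (intro bexI[OF _ C] allI impI)
    fix \<chi> :: "('a, 'j) ordered_lj_structure \<Rightarrow> nat"
    assume \<chi>: "\<chi> ` copies J A C \<subseteq> {..<k}"
    \<comment> \<open>the leading letter \<open>0\<close> accounts for the largest atom, the only constant of the words\<close>
    define copy where "copy w = induced C (h ` word_preimage (0 # w) ` univ (power_structure ({} # as)))" for w
    \<comment> \<open>colours are reduced modulo \<open>k\<close> because the bound is known for copies only\<close>
    obtain u c where u: "pword 1 bs cs u"
      and c: "\<And>v. pword 1 as bs v \<Longrightarrow> \<chi> (copy (plug ([0..<1] @ v) u)) mod k = c"
      using ramsey[unfolded ramsey_words_def, rule_format, of "\<lambda>w. \<chi> (copy w) mod k"] k by auto
    define e where "e = h \<circ> word_preimage (0 # u) \<circ> \<beta>"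
    have e: "embedding J B C e" unfolding e_def by (rule word_copy[OF \<beta>(1) u])
    show "\<exists>B'\<in>copies J B C. \<exists>c. \<forall>A'\<in>copies J A B'. \<chi> A' = c"
    proof (intro bexI[of _ "induced C (e ` univ B)"] exI[of _ c] ballI)
      show "induced C (e ` univ B) \<in> copies J B C"
        using e copies_eq[OF subuniverse_NA_Bu[OF B]] by blast
      fix A' assume "A' \<in> copies J A (induced C (e ` univ B))"
      then obtain g where g: "A' = induced (induced C (e ` univ B)) (g ` univ A)"
        "embedding J A (induced C (e ` univ B)) g"
        using copies_eq[OF subuniverse_NA_Bu[OF A]] by blast
      have "g ` univ A \<subseteq> e ` univ B" using g(2) by (auto simp: embedding_def induced_def)
      then have A': "A' = induced C (g ` univ A)" unfolding g(1) by (rule induced_induced)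
      obtain f where f: "embedding J A B f" "g ` univ A = e ` f ` univ A"
        using embedding_into_copy_factors[OF subuniverse_NA_Bu[OF B] e g(2)] by blast
      let ?\<alpha>' = "inv_into (univ A) \<alpha>"
      have "embedding J (power_structure ({} # as)) A ?\<alpha>'"
        by (rule embedding_inv_into[OF subuniverse_NA_Bu[OF A] \<alpha>])
      then have "embedding J (power_structure ({} # as)) (power_structure ({} # bs)) (\<beta> \<circ> f \<circ> ?\<alpha>')"
        by (rule embedding_compose[OF _ embedding_compose[OF f(1) \<beta>(1)]])
      from embedding_is_word[OF as bs this] obtain w where w: "pword 0 ({} # as) ({} # bs) w"
        and w_eq: "\<forall>X\<subseteq>{..<length ({} # as)}. (\<beta> \<circ> f \<circ> ?\<alpha>') X = word_preimage w X"
        by (elim exE conjE) (rule that)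
      obtain v where v: "w = 0 # v" "pword 1 as bs v" using w by (cases w) auto
      have "e ` f ` univ A = h ` word_preimage (0 # u) ` \<beta> ` f ` univ A"
        by (simp add: e_def image_comp)
      also have "\<beta> ` f ` univ A = (\<beta> \<circ> f \<circ> ?\<alpha>') ` univ (power_structure ({} # as))"
      proof -
        have "?\<alpha>' ` univ (power_structure ({} # as)) = univ A"
          using \<alpha> unfolding embedding_def by (metis inv_into_image_cancel order_refl)
        then show ?thesis by (simp only: image_comp[symmetric])
      qed
      also have "\<dots> = word_preimage (0 # v) ` univ (power_structure ({} # as))"
        using w_eq v(1) by (intro image_cong) (simp_all del: length_Cons)
      also have "word_preimage (0 # u) ` word_preimage (0 # v) ` univ (power_structure ({} # as))
          = word_preimage (0 # plug ([0..<1] @ v) u) ` univ (power_structure ({} # as))"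
        unfolding image_image using pword_letters[OF u] pword_length[OF v(2)]
        by (intro image_cong) (auto simp: word_preimage_plug simp del: length_Cons)
      finally have copy: "A' = copy (plug ([0..<1] @ v) u)"
        unfolding A' f(2) copy_def by simp
      have "embedding J A C (e \<circ> f)" by (rule embedding_compose[OF f(1) e])
      then have "A' \<in> copies J A C"
        unfolding copies_eq[OF subuniverse_NA_Bu[OF A]] A' f(2) image_comp by blast
      then show "\<chi> A' = c" using \<chi> c[OF v(2)] copy by auto
    qed
  qed
qed

end
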